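(* The fundamental group of the join of a finite family of (pointed) wild pseudo Peano continuum spaces is isomorphic to the coproduct of their fundamental groups in the category $\pi(\mathbf{Top^w})$.
   Context: A pseudo Peano continuum space is a one-dimensional (topological covering dimension $1$), locally path connected, path connected, metric space. A point $x$ of a space $X$ is wild if $X$ is not semilocally simply connected at $x$, i.e. there is no open neighbourhood $U$ of $x$ for which the inclusion $U\hookrightarrow X$ induces the trivial homomorphism $\pi(U,x)\to\pi(X,x)$, where $\pi$ denotes the fundamental group. $X$ is wild if all of its points are wild. The join $(X,x)=\bigvee_{i\in I}(X_i,x_i)$ of pointed spaces $(X_i,x_i)$ is the quotient of the disjoint union of the $X_i$ by the relation identifying all the points $x_i$ to a single point $x$. $\mathbf{Top^w}$ is the subcategory of the category of pointed spaces consisting of all wild pseudo Peano continuum spaces and all morphisms between them. $\pi(\mathbf{Top^w})$ is the subcategory of the category of groups consisting of all fundamental groups of wild pseudo Peano continuum spaces and all homomorphisms induced by maps between these spaces. *)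

theory Defs
  imports "HOL-Analysis.Analysis" "HOL-Algebra.Coset"
begin

text \<open>
  Loops are functions on the reals of which only the restriction to \<open>{0..1}\<close> matters.  A class
  contains every function whose restriction to \<open>{0..1}\<close> is a loop of the right homotopy type,
  so the values outside \<open>{0..1}\<close> do not affect the elements of the fundamental group.
\<close>

definition loops :: "'a topology \<Rightarrow> 'a \<Rightarrow> (real \<Rightarrow> 'a) set" where
  "loops X x = {p. pathin X p \<and> p 0 = x \<and> p 1 = x}"

definition loop_class :: "'a topology \<Rightarrow> 'a \<Rightarrow> (real \<Rightarrow> 'a) \<Rightarrow> (real \<Rightarrow> 'a) set" where
  "loop_class X x p =
     {q. homotopic_with (\<lambda>r. r 0 = x \<and> r 1 = x) (top_of_set {0..1}) X p q}"

text \<open>The library's concatenation \<open>(+++)\<close> is restricted to types of a topological type class.\<close>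

definition loop_concat :: "(real \<Rightarrow> 'a) \<Rightarrow> (real \<Rightarrow> 'a) \<Rightarrow> real \<Rightarrow> 'a" where
  "loop_concat p q = (\<lambda>t. if t \<le> 1/2 then p (2 * t) else q (2 * t - 1))"

definition fundamental_group :: "'a topology \<Rightarrow> 'a \<Rightarrow> (real \<Rightarrow> 'a) set monoid" where
  "fundamental_group X x =
     \<lparr>carrier = loop_class X x ` loops X x,
      mult = (\<lambda>A B. \<Union>p\<in>A. \<Union>q\<in>B. loop_class X x (loop_concat p q)),
      one = loop_class X x (\<lambda>_. x)\<rparr>"

text \<open>
  For a continuous \<open>f\<close> with \<open>f x = y\<close>, all the classes in the union coincide.  Induced maps are
  extensional (undefined outside the carrier), so that two of them are equal as HOL functions
  iff they agree on the fundamental group.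
\<close>

definition induced_hom ::
  "'a topology \<Rightarrow> 'a \<Rightarrow> 'b topology \<Rightarrow> 'b \<Rightarrow> ('a \<Rightarrow> 'b) \<Rightarrow> (real \<Rightarrow> 'a) set \<Rightarrow> (real \<Rightarrow> 'b) set" where
  "induced_hom X x Y y f =
     (\<lambda>A \<in> carrier (fundamental_group X x). \<Union>p\<in>A. loop_class Y y (f \<circ> p))"

text \<open>
  This is the Lebesgue covering dimension.  The library's \<open>dim_le\<close> is the small inductive
  dimension, which may be different for metrizable spaces that are not separable.
\<close>

definition covering_dim_le :: "'a topology \<Rightarrow> nat \<Rightarrow> bool" where
  "covering_dim_le X n \<longleftrightarrow>
     (\<forall>\<U>. (\<forall>U\<in>\<U>. openin X U) \<and> \<Union>\<U> = topspace X \<longrightarrow>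
        (\<exists>\<V>. (\<forall>V\<in>\<V>. openin X V) \<and> \<Union>\<V> = topspace X \<and>
             (\<forall>V\<in>\<V>. \<exists>U\<in>\<U>. V \<subseteq> U) \<and>
             (\<forall>x\<in>topspace X. finite {V\<in>\<V>. x \<in> V} \<and> card {V\<in>\<V>. x \<in> V} \<le> n + 1)))"

definition has_covering_dim :: "'a topology \<Rightarrow> nat \<Rightarrow> bool" where
  "has_covering_dim X n \<longleftrightarrow>
     topspace X \<noteq> {} \<and> covering_dim_le X n \<and> (\<forall>m<n. \<not> covering_dim_le X m)"

definition pseudo_peano :: "'a topology \<Rightarrow> bool" where
  "pseudo_peano X \<longleftrightarrow>
     metrizable_space X \<and> has_covering_dim X 1 \<and>
     locally_path_connected_space X \<and> path_connected_space X"

definition semilocally_simply_connected_at :: "'a topology \<Rightarrow> 'a \<Rightarrow> bool" where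
  "semilocally_simply_connected_at X x \<longleftrightarrow>
     (\<exists>U. openin X U \<and> x \<in> U \<and>
        trivial_homomorphism (fundamental_group (subtopology X U) x) (fundamental_group X x)
          (induced_hom (subtopology X U) x X x id))"

definition wild_space :: "'a topology \<Rightarrow> bool" where
  "wild_space X \<longleftrightarrow> (\<forall>x\<in>topspace X. \<not> semilocally_simply_connected_at X x)"

definition Topw_obj :: "'a topology \<Rightarrow> 'a \<Rightarrow> bool" where
  "Topw_obj X x \<longleftrightarrow> pseudo_peano X \<and> wild_space X \<and> x \<in> topspace X"

definition pointed_maps :: "'a topology \<Rightarrow> 'a \<Rightarrow> 'b topology \<Rightarrow> 'b \<Rightarrow> ('a \<Rightarrow> 'b) set" where
  "pointed_maps X x Y y = {f. continuous_map X Y f \<and> f x = y}"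

text \<open>
  The objects of \<open>\<pi>(Top\<^sup>w)\<close> are the groups \<open>fundamental_group X x\<close> with \<open>Topw_obj X x\<close>; they are
  referred to through the pointed space \<open>(X, x)\<close>.  The following are the morphisms from
  \<open>fundamental_group X x\<close> to \<open>fundamental_group Y y\<close>.  The composite of \<open>g\<close> after \<open>f\<close> with source
  \<open>G\<close> is \<open>compose (carrier G) g f\<close>.
\<close>

definition pi_hom ::
  "'a topology \<Rightarrow> 'a \<Rightarrow> 'b topology \<Rightarrow> 'b \<Rightarrow> ((real \<Rightarrow> 'a) set \<Rightarrow> (real \<Rightarrow> 'b) set) set" where
  "pi_hom X x Y y = induced_hom X x Y y ` pointed_maps X x Y y"

definition pi_iso :: "'a topology \<Rightarrow> 'a \<Rightarrow> 'b topology \<Rightarrow> 'b \<Rightarrow> bool" where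
  "pi_iso X x Y y \<longleftrightarrow>
     (\<exists>u \<in> pi_hom X x Y y. \<exists>v \<in> pi_hom Y y X x.
        compose (carrier (fundamental_group X x)) v u
          = (\<lambda>A \<in> carrier (fundamental_group X x). A) \<and>
        compose (carrier (fundamental_group Y y)) u v
          = (\<lambda>A \<in> carrier (fundamental_group Y y). A))"

text \<open>
  \<open>pi_coproduct TYPE('c) I X x Z z j\<close>: the object \<open>fundamental_group Z z\<close> with the injections
  \<open>j i\<close> is a coproduct of the objects \<open>fundamental_group (X i) (x i)\<close> in \<open>\<pi>(Top\<^sup>w)\<close>.  HOL cannot
  quantify over types inside a formula, so the type \<open>'c\<close> of the points of the spaces against
  which the universal property is tested is a parameter.
\<close>

definition pi_coproduct ::
  "'c itself \<Rightarrow> 'i set \<Rightarrow> ('i \<Rightarrow> 'a topology) \<Rightarrow> ('i \<Rightarrow> 'a) \<Rightarrow> 'b topology \<Rightarrow> 'b \<Rightarrow>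
   ('i \<Rightarrow> (real \<Rightarrow> 'a) set \<Rightarrow> (real \<Rightarrow> 'b) set) \<Rightarrow> bool" where
  "pi_coproduct (_ :: 'c itself) I X x Z z j \<longleftrightarrow>
     Topw_obj Z z \<and>
     (\<forall>i\<in>I. j i \<in> pi_hom (X i) (x i) Z z) \<and>
     (\<forall>(Y :: 'c topology) y h.
        Topw_obj Y y \<and> (\<forall>i\<in>I. h i \<in> pi_hom (X i) (x i) Y y) \<longrightarrow>
        (\<exists>!u. u \<in> pi_hom Z z Y y \<and>
              (\<forall>i\<in>I. compose (carrier (fundamental_group (X i) (x i))) u (j i) = h i)))"

definition quotient_topology :: "'a topology \<Rightarrow> ('a \<times> 'a) set \<Rightarrow> 'a set topology" where
  "quotient_topology X R = topology (\<lambda>U. U \<subseteq> topspace X // R \<and> openin X (\<Union>U))"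

lemma openin_quotient_topology:
  assumes "equiv (topspace X) R"
  shows "openin (quotient_topology X R) U \<longleftrightarrow> U \<subseteq> topspace X // R \<and> openin X (\<Union>U)"
proof -
  have inter: "\<Union>(S \<inter> T) = \<Union>S \<inter> \<Union>T"
    if "S \<subseteq> topspace X // R" "T \<subseteq> topspace X // R" for S T
  proof
    show "\<Union>S \<inter> \<Union>T \<subseteq> \<Union>(S \<inter> T)"
    proof
      fix a assume "a \<in> \<Union>S \<inter> \<Union>T"
      then obtain A B where "A \<in> S" "B \<in> T" "a \<in> A" "a \<in> B"
        by blast
      moreover from this have "A = B"
        using quotient_disj[OF assms, of A B] that by blast
      ultimately show "a \<in> \<Union>(S \<inter> T)"
        by blast
    qed
  qed blast
  have unions: "openin X (\<Union>(\<Union>\<K>))" if "\<forall>K\<in>\<K>. openin X (\<Union>K)" for \<K>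
  proof -
    have "\<Union>(\<Union>\<K>) = (\<Union>K\<in>\<K>. \<Union>K)"
      by blast
    then show ?thesis
      using that by auto
  qed
  have "istopology (\<lambda>U. U \<subseteq> topspace X // R \<and> openin X (\<Union>U))"
    unfolding istopology_def
  proof (rule conjI; intro allI impI)
    fix S T
    assume "S \<subseteq> topspace X // R \<and> openin X (\<Union>S)" "T \<subseteq> topspace X // R \<and> openin X (\<Union>T)"
    then show "S \<inter> T \<subseteq> topspace X // R \<and> openin X (\<Union>(S \<inter> T))"
      by (metis inter le_infI1 openin_Int)
  next
    fix \<K>
    assume "\<forall>K\<in>\<K>. K \<subseteq> topspace X // R \<and> openin X (\<Union>K)"
    then show "\<Union>\<K> \<subseteq> topspace X // R \<and> openin X (\<Union>(\<Union>\<K>))"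
      using unions by blast
  qed
  then show ?thesis
    by (simp add: quotient_topology_def)
qed

lemma topspace_quotient_topology:
  assumes "equiv (topspace X) R"
  shows "topspace (quotient_topology X R) = topspace X // R"
proof -
  have "openin (quotient_topology X R) (topspace X // R)"
    by (simp add: openin_quotient_topology[OF assms] Union_quotient[OF assms])
  then show ?thesis
    by (meson assms openin_quotient_topology openin_subset openin_topspace subset_antisym)
qed

definition join_base :: "'i set \<Rightarrow> ('i \<Rightarrow> 'a) \<Rightarrow> ('i \<times> 'a) set" where
  "join_base I x = {(i, x i) | i. i \<in> I}"

definition join_rel :: "'i set \<Rightarrow> ('i \<Rightarrow> 'a topology) \<Rightarrow> ('i \<Rightarrow> 'a) \<Rightarrow> (('i \<times> 'a) \<times> ('i \<times> 'a)) set" where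
  "join_rel I X x = Id_on (topspace (sum_topology X I)) \<union> join_base I x \<times> join_base I x"

lemma equiv_join_rel:
  assumes "\<And>i. i \<in> I \<Longrightarrow> x i \<in> topspace (X i)"
  shows "equiv (topspace (sum_topology X I)) (join_rel I X x)"
  using assms
  by (fastforce simp: join_rel_def join_base_def equiv_def refl_on_def sym_def trans_def)

definition join_space :: "'i set \<Rightarrow> ('i \<Rightarrow> 'a topology) \<Rightarrow> ('i \<Rightarrow> 'a) \<Rightarrow> ('i \<times> 'a) set topology" where
  "join_space I X x = quotient_topology (sum_topology X I) (join_rel I X x)"

text \<open>
  The basepoint of the join is the class that consists of all the basepoints (provided \<open>I\<close> is
  nonempty); every other class is a singleton.
\<close>

definition join_in :: "'i set \<Rightarrow> ('i \<Rightarrow> 'a topology) \<Rightarrow> ('i \<Rightarrow> 'a) \<Rightarrow> 'i \<Rightarrow> 'a \<Rightarrow> ('i \<times> 'a) set" where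
  "join_in I X x i a = join_rel I X x `` {(i, a)}"

definition join_injection ::
  "'i set \<Rightarrow> ('i \<Rightarrow> 'a topology) \<Rightarrow> ('i \<Rightarrow> 'a) \<Rightarrow> 'i \<Rightarrow> (real \<Rightarrow> 'a) set \<Rightarrow> (real \<Rightarrow> ('i \<times> 'a) set) set" where
  "join_injection I X x i =
     induced_hom (X i) (x i) (join_space I X x) (join_base I x) (join_in I X x i)"

end

theory Submission
  imports Defs
begin

text \<open>
  Continuous pointed maps out of a join correspond to families of pointed maps, so only the
  uniqueness of the mediating morphism is at issue: two maps \<open>f, g\<close> from the join to \<open>Y\<close> that
  induce the same homomorphisms on the summands must induce the same homomorphism on the join,
  although its fundamental group is not generated by those of the summands. A loop \<open>l\<close> in the join is
  an infinite concatenation of loops in the summands, so the homotopies between the corresponding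
  pieces of \<open>f \<circ> l\<close> and \<open>g \<circ> l\<close> can be pasted as soon as those of the small pieces are small. This is
  where \<open>dim Y \<le> 1\<close> enters: a neighbourhood of the base point \<open>y\<close> contains a smaller one whose
  boundary \<open>L\<close> is totally disconnected. If \<open>F\<close> maps a square to \<open>Y\<close> and its boundary close to \<open>y\<close>,
  then the components of the complement of the outermost component of the complement of
  \<open>F -` L\<close> have connected frontiers, which are mapped to single points of \<open>L\<close>; making \<open>F\<close> constant
  on these components yields a map that stays close to \<open>y\<close>.
\<close>

section \<open>Covering dimension and partitions\<close>

text \<open>The homotopies between corresponding pieces are given one loop at a time and with no
  bound on their size. Pasted as they stand, they could fail to be continuous where shorter and
  shorter pieces accumulate. The remedy needs a bound that does not depend on the given homotopy: in
  dimension one it can be replaced by a homotopy that stays within twice the distance from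
  \<open>y\<close> reached on the boundary of the square, and for short pieces this distance is
  small by uniform continuity of the two paths. Connectedness of the frontiers is the unicoherence
  of Euclidean space; it is the only place where the topology of the square matters.
  \<open>Y\<close> may be non-separable, so the totally disconnected boundary is constructed
  directly from open covers of order two and not taken from an inductive dimension.\<close>

lemma covering_dim_leD:
  assumes "covering_dim_le X n" and "\<And>U. U \<in> \<U> \<Longrightarrow> openin X U" and "\<Union>\<U> = topspace X"
  shows "\<exists>\<V>. (\<forall>V\<in>\<V>. openin X V) \<and> \<Union>\<V> = topspace X \<and> (\<forall>V\<in>\<V>. \<exists>U\<in>\<U>. V \<subseteq> U) \<and>
    (\<forall>x\<in>topspace X. finite {V\<in>\<V>. x \<in> V} \<and> card {V\<in>\<V>. x \<in> V} \<le> n + 1)"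
  by (rule assms(1)[unfolded covering_dim_le_def, THEN spec, THEN mp]) (simp add: assms)

text \<open>A cover of \<open>X\<close> is pulled back along \<open>r\<close>, refined in
  \<open>Z\<close>, and the refinement is pulled back along \<open>j\<close>. As \<open>r\<close>
  undoes \<open>j\<close>, the result refines the original cover, and its members at
  \<open>a\<close> come from members at \<open>j a\<close>. Summands are retracts of the join, so
  the join cannot have dimension zero.\<close>

lemma covering_dim_le_retract:
  assumes j: "continuous_map X Z j" and r: "continuous_map Z X r"
    and rj: "\<And>a. a \<in> topspace X \<Longrightarrow> r (j a) = a"
    and Z: "covering_dim_le Z n"
  shows "covering_dim_le X n"
  unfolding covering_dim_le_def
proof (intro allI impI)
  fix \<U> assume \<U>: "(\<forall>U\<in>\<U>. openin X U) \<and> \<Union>\<U> = topspace X"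
  define pr where "pr U = {z \<in> topspace Z. r z \<in> U}" for U
  define pj where "pj V = {a \<in> topspace X. j a \<in> V}" for V
  have jZ: "j a \<in> topspace Z" if "a \<in> topspace X" for a
    using j that by (auto simp: continuous_map_def)
  have "openin Z U" if "U \<in> pr ` \<U>" for U
    using that \<U> r by (auto simp: pr_def openin_continuous_map_preimage)
  moreover have "\<Union>(pr ` \<U>) = topspace Z"
    using \<U> r by (fastforce simp: pr_def continuous_map_def)
  ultimately have "\<exists>\<V>. (\<forall>V\<in>\<V>. openin Z V) \<and> \<Union>\<V> = topspace Z \<and> (\<forall>V\<in>\<V>. \<exists>U\<in>pr ` \<U>. V \<subseteq> U) \<and>
      (\<forall>z\<in>topspace Z. finite {V\<in>\<V>. z \<in> V} \<and> card {V\<in>\<V>. z \<in> V} \<le> n + 1)"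
    by (rule covering_dim_leD[OF Z])
  then obtain \<V> where \<V>: "\<forall>V\<in>\<V>. openin Z V" "\<Union>\<V> = topspace Z" "\<forall>V\<in>\<V>. \<exists>U\<in>pr ` \<U>. V \<subseteq> U"
    "\<forall>z\<in>topspace Z. finite {V\<in>\<V>. z \<in> V} \<and> card {V\<in>\<V>. z \<in> V} \<le> n + 1"
    by (elim exE conjE) (rule that)
  show "\<exists>\<V>. (\<forall>V\<in>\<V>. openin X V) \<and> \<Union>\<V> = topspace X \<and> (\<forall>V\<in>\<V>. \<exists>U\<in>\<U>. V \<subseteq> U) \<and>
      (\<forall>x\<in>topspace X. finite {V \<in> \<V>. x \<in> V} \<and> card {V \<in> \<V>. x \<in> V} \<le> n + 1)"
  proof (intro exI[of _ "pj ` \<V>"] conjI ballI)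
    show "openin X V" if "V \<in> pj ` \<V>" for V
      using that \<V>(1) j by (auto simp: pj_def openin_continuous_map_preimage)
    show "\<Union>(pj ` \<V>) = topspace X" using \<V>(2) jZ by (auto simp: pj_def)
    show "\<exists>U\<in>\<U>. V \<subseteq> U" if V: "V \<in> pj ` \<V>" for V
    proof -
      obtain V' U where "V' \<in> \<V>" "V = pj V'" "U \<in> \<U>" "V' \<subseteq> pr U" using V \<V>(3) by blast
      then have "V \<subseteq> U" using rj by (auto simp: pj_def pr_def)
      then show ?thesis using \<open>U \<in> \<U>\<close> by blast
    qed
    fix a assume a: "a \<in> topspace X"
    have sub: "{V \<in> pj ` \<V>. a \<in> V} \<subseteq> pj ` {V \<in> \<V>. j a \<in> V}" by (auto simp: pj_def)
    have fin: "finite {V \<in> \<V>. j a \<in> V}" "card {V \<in> \<V>. j a \<in> V} \<le> n + 1"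
      using \<V>(4) jZ a by auto
    show "finite {V \<in> pj ` \<V>. a \<in> V}" using sub fin by (meson finite_imageI finite_subset)
    show "card {V \<in> pj ` \<V>. a \<in> V} \<le> n + 1"
      using card_mono[OF finite_imageI[OF fin(1)] sub] card_image_le[OF fin(1), of pj] fin(2) by linarith
  qed
qed

text \<open>A cover of order two by small sets splits into the members \<open>\<G>\<close> that meet
  \<open>clV\<close> and the others, \<open>\<H>\<close>. What remains between \<open>V'\<close> and
  \<open>W'\<close> is covered by both families, so each of its points lies in exactly one
  \<open>P \<in> \<G>\<close> and one \<open>Q \<in> \<H>\<close>. The sets
  \<open>P \<inter> Q\<close> therefore cut it into disjoint relatively open pieces, and a connected
  subset stays in one small piece.\<close>

lemma (in Metric_space) fine_partition_step:
  assumes dim: "covering_dim_le mtopology 1" and e: "e > 0"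
    and VW: "disjnt (mtopology closure_of V) (mtopology closure_of W)"
  obtains V' W' where "openin mtopology V'" "openin mtopology W'"
    "disjnt (mtopology closure_of V') (mtopology closure_of W')"
    "mtopology closure_of V \<subseteq> V'" "mtopology closure_of W \<subseteq> W'"
    "\<And>T a b. \<lbrakk>connectedin mtopology T; T \<inter> V' = {}; T \<inter> W' = {}; a \<in> T; b \<in> T\<rbrakk> \<Longrightarrow> d a b < e"
proof -
  define clV where "clV = mtopology closure_of V"
  define clW where "clW = mtopology closure_of W"
  have cl: "closedin mtopology clV" "closedin mtopology clW" "disjnt clV clW"
    using VW by (auto simp: clV_def clW_def)
  \<comment> \<open>No point is in both closures, so this is a cover. A set of the refinement that
    meets \<open>clV\<close> can only lie in a member of the second kind and hence misses
    \<open>clW\<close>.\<close>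
  define \<U> where "\<U> = {mball z (e/2) - clV | z. z \<in> M} \<union> {mball z (e/2) - clW | z. z \<in> M}"
  have "openin mtopology U" if "U \<in> \<U>" for U
    using that cl by (auto simp: \<U>_def)
  moreover have "\<Union>\<U> = topspace mtopology"
  proof
    show "topspace mtopology \<subseteq> \<Union>\<U>"
    proof
      fix z assume z: "z \<in> topspace mtopology"
      then have "z \<in> mball z (e/2)" using e by simp
      then have "z \<in> mball z (e/2) - clV \<or> z \<in> mball z (e/2) - clW"
        using cl by (auto simp: disjnt_iff)
      moreover have "mball z (e/2) - clV \<in> \<U>" "mball z (e/2) - clW \<in> \<U>"
        using z by (auto simp: \<U>_def)
      ultimately show "z \<in> \<Union>\<U>" by blast
    qed
  qed (auto simp: \<U>_def)
  ultimately have "\<exists>\<V>. (\<forall>P\<in>\<V>. openin mtopology P) \<and> \<Union>\<V> = topspace mtopology \<and>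
      (\<forall>P\<in>\<V>. \<exists>U\<in>\<U>. P \<subseteq> U) \<and>
      (\<forall>z\<in>topspace mtopology. finite {P\<in>\<V>. z \<in> P} \<and> card {P\<in>\<V>. z \<in> P} \<le> 1 + 1)"
    by (rule covering_dim_leD[OF dim])
  then obtain \<V> where op: "\<forall>P\<in>\<V>. openin mtopology P" and cov: "\<Union>\<V> = M"
    and ref: "\<forall>P\<in>\<V>. \<exists>U\<in>\<U>. P \<subseteq> U"
    and ord: "\<forall>z\<in>M. finite {P\<in>\<V>. z \<in> P} \<and> card {P\<in>\<V>. z \<in> P} \<le> 2"
    unfolding topspace_mtopology one_add_one by (elim exE conjE) (rule that)
  define \<G> where "\<G> = {P\<in>\<V>. P \<inter> clV \<noteq> {}}"
  define \<H> where "\<H> = {P\<in>\<V>. P \<inter> clV = {}}"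
  have GW: "P \<inter> clW = {}" if "P \<in> \<G>" for P
    using that ref by (fastforce simp: \<G>_def \<U>_def)
  have opGH: "openin mtopology (\<Union>\<G>)" "openin mtopology (\<Union>\<H>)"
    using op by (auto simp: \<G>_def \<H>_def)
  have GH: "\<Union>\<G> \<union> \<Union>\<H> = M"
    using cov by (auto simp: \<G>_def \<H>_def)
  \<comment> \<open>The sets of points missed by \<open>\<H>\<close> and by \<open>\<G>\<close> are
    disjoint and contain \<open>clV\<close> and \<open>clW\<close>. Normality thickens them to open
    sets with disjoint closures, which is what the next round of the iteration starts from.\<close>
  have "closedin mtopology (M - \<Union>\<H>)" "closedin mtopology (M - \<Union>\<G>)"
    using opGH by (simp_all add: closedin_diff)
  moreover have "disjnt (M - \<Union>\<H>) (M - \<Union>\<G>)"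
    using GH by (auto simp: disjnt_iff)
  ultimately have "\<exists>V' W'. openin mtopology V' \<and> openin mtopology W' \<and> M - \<Union>\<H> \<subseteq> V' \<and> M - \<Union>\<G> \<subseteq> W' \<and>
      disjnt (mtopology closure_of V') (mtopology closure_of W')"
    using normal_space_mtopology[unfolded normal_space_disjoint_closures] by simp
  then obtain V' W' where VW': "openin mtopology V'" "openin mtopology W'"
     "M - \<Union>\<H> \<subseteq> V'" "M - \<Union>\<G> \<subseteq> W'" "disjnt (mtopology closure_of V') (mtopology closure_of W')"
    by (elim exE conjE) (rule that)
  show ?thesis
  proof
    have "clV \<subseteq> M - \<Union>\<H>" using cl closedin_subset by (fastforce simp: \<H>_def)
    then show "mtopology closure_of V \<subseteq> V'" using VW' clV_def by blast
    have "clW \<subseteq> M - \<Union>\<G>" using cl GW closedin_subset by fastforce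
    then show "mtopology closure_of W \<subseteq> W'" using VW' clW_def by blast
    fix T a b
    assume T: "connectedin mtopology T" "T \<inter> V' = {}" "T \<inter> W' = {}" and ab: "a \<in> T" "b \<in> T"
    have TM: "T \<subseteq> M" using T connectedin_subset_topspace by fastforce
    have TGH: "T \<subseteq> \<Union>\<G> \<inter> \<Union>\<H>" using TM T VW' by blast
    obtain P Q where PQ: "a \<in> P" "a \<in> Q" "P \<in> \<G>" "Q \<in> \<H>" using TGH ab by blast
    \<comment> \<open>\<open>R\<close> collects all other intersections. A point of \<open>T\<close>
      in both \<open>P \<inter> Q\<close> and \<open>R\<close> would lie in at least three members
      of \<open>\<V>\<close>.\<close>
    define R where "R = \<Union>{P' \<inter> Q' | P' Q'. P' \<in> \<G> \<and> Q' \<in> \<H> \<and> (P',Q') \<noteq> (P,Q)}"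
    have "openin mtopology R"
      unfolding R_def using op by (auto simp: \<G>_def \<H>_def intro!: openin_Union)
    moreover have "openin mtopology (P \<inter> Q)" using PQ op by (auto simp: \<G>_def \<H>_def)
    moreover have TPQ: "T \<subseteq> (P \<inter> Q) \<union> R"
    proof
      fix z assume "z \<in> T"
      then obtain P' Q' where z: "z \<in> P'" "z \<in> Q'" "P' \<in> \<G>" "Q' \<in> \<H>" using TGH by blast
      show "z \<in> (P \<inter> Q) \<union> R"
      proof (cases "(P',Q') = (P,Q)")
        case False
        then have "P' \<inter> Q' \<subseteq> R" using z unfolding R_def by blast
        then show ?thesis using z by blast
      qed (use z in auto)
    qed
    moreover have "(P \<inter> Q) \<inter> R \<inter> T = {}"
    proof -
      have False if zPQR: "z \<in> P" "z \<in> Q" "z \<in> R" "z \<in> T" for z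
      proof -
        obtain P' Q' where z: "z \<in> P'" "z \<in> Q'" "P' \<in> \<G>" "Q' \<in> \<H>" "(P',Q') \<noteq> (P,Q)"
          using zPQR(3) unfolding R_def by blast
        have S: "finite {P\<in>\<V>. z \<in> P}" "card {P\<in>\<V>. z \<in> P} \<le> 2"
          using ord TM zPQR by auto
        have ne: "P \<noteq> Q" "P' \<noteq> Q" "P \<noteq> Q'"
          using PQ z by (auto simp: \<G>_def \<H>_def)
        have sub: "{P, Q} \<subseteq> {P\<in>\<V>. z \<in> P}" and mem: "P' \<in> {P\<in>\<V>. z \<in> P}" "Q' \<in> {P\<in>\<V>. z \<in> P}"
          using PQ z zPQR by (auto simp: \<G>_def \<H>_def)
        have "card {P, Q} = 2" using ne by simp
        then have "{P, Q} = {P\<in>\<V>. z \<in> P}"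
          using S by (intro card_seteq[OF _ sub]) auto
        then have "P' \<in> {P, Q}" "Q' \<in> {P, Q}" using mem by blast+
        then show False using z(5) ne by auto
      qed
      then show ?thesis by blast
    qed
    moreover have "(P \<inter> Q) \<inter> T \<noteq> {}" using PQ ab by blast
    ultimately have "R \<inter> T = {}"
      using T(1) unfolding connectedin by blast
    then have "b \<in> P" using TPQ ab by blast
    obtain z where "z \<in> M" "P \<subseteq> mball z (e/2)"
      using ref PQ(3) by (fastforce simp: \<G>_def \<U>_def)
    then have "d z a < e/2" "d z b < e/2" "a \<in> M" "b \<in> M"
      using PQ \<open>b \<in> P\<close> by auto
    then show "d a b < e"
      using triangle[of a z b] \<open>z \<in> M\<close> commute[of a z] by auto
  qed (use VW' in auto)
qed

text \<open>The classical inequality between the large inductive and the covering dimension in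
  dimension one; the totally disconnected partition is the intersection of ever finer ones.\<close>
lemma (in Metric_space) totally_disconnected_partition:
  assumes dim: "covering_dim_le mtopology 1"
    and "closedin mtopology A" "closedin mtopology B" "disjnt A B"
  obtains V W where "openin mtopology V" "openin mtopology W" "disjnt V W" "A \<subseteq> V" "B \<subseteq> W"
    "\<And>T a b. \<lbrakk>connectedin mtopology T; T \<inter> V = {}; T \<inter> W = {}; a \<in> T; b \<in> T\<rbrakk> \<Longrightarrow> a = b"
proof -
  define cl where "cl = (closure_of) mtopology"
  define Inv where "Inv = (\<lambda>(n::nat) (V, W).
     openin mtopology V \<and> openin mtopology W \<and> disjnt (cl V) (cl W) \<and> A \<subseteq> V \<and> B \<subseteq> W)"
  \<comment> \<open>Since each stage swallows the closures of the previous one, both sequences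
    increase and remain disjoint. A set that misses the two unions misses every stage, so its
    connected subsets have diameter below every \<open>inverse (Suc n)\<close>.\<close>
  define Nxt where "Nxt = (\<lambda>(n::nat) (V, W) (V', W'). cl V \<subseteq> V' \<and> cl W \<subseteq> W' \<and>
     (\<forall>T a b. connectedin mtopology T \<and> T \<inter> V' = {} \<and> T \<inter> W' = {} \<and> a \<in> T \<and> b \<in> T
        \<longrightarrow> d a b < inverse (Suc n)))"
  have sub: "V \<subseteq> cl V" if "openin mtopology V" for V
    unfolding cl_def using that by (meson closure_of_subset openin_subset)
  have "\<exists>f. \<forall>n. Inv n (f n) \<and> Nxt n (f n) (f (Suc n))"
  proof (rule dependent_nat_choice)
    obtain V W where "openin mtopology V" "openin mtopology W" "A \<subseteq> V" "B \<subseteq> W" "disjnt (cl V) (cl W)"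
      using assms normal_space_mtopology unfolding normal_space_disjoint_closures cl_def by meson
    then show "\<exists>VW. Inv 0 VW" by (auto simp: Inv_def)
  next
    fix VW n assume *: "Inv n VW"
    obtain V W where VW: "VW = (V, W)" by fastforce
    have *: "openin mtopology V" "openin mtopology W" "disjnt (cl V) (cl W)" "A \<subseteq> V" "B \<subseteq> W"
      using * by (auto simp: Inv_def VW)
    have "inverse (real (Suc n)) > 0" by simp
    from fine_partition_step[OF dim this *(3)[unfolded cl_def]] obtain V' W' where
      "openin mtopology V'" "openin mtopology W'" "disjnt (cl V') (cl W')" "cl V \<subseteq> V'" "cl W \<subseteq> W'"
      "\<And>T a b. \<lbrakk>connectedin mtopology T; T \<inter> V' = {}; T \<inter> W' = {}; a \<in> T; b \<in> T\<rbrakk>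
         \<Longrightarrow> d a b < inverse (real (Suc n))"
      unfolding cl_def by metis
    then have "Inv (Suc n) (V', W') \<and> Nxt n VW (V', W')"
      using * sub[of V] sub[of W] unfolding Inv_def Nxt_def VW by auto
    then show "\<exists>VW'. Inv (Suc n) VW' \<and> Nxt n VW VW'" by (rule exI)
  qed
  then obtain f where f: "\<And>n. Inv n (f n)" "\<And>n. Nxt n (f n) (f (Suc n))" by blast
  define V where "V n = fst (f n)" for n
  define W where "W n = snd (f n)" for n
  have I: "openin mtopology (V n)" "openin mtopology (W n)" "disjnt (cl (V n)) (cl (W n))" "A \<subseteq> V n" "B \<subseteq> W n" for n
    using f(1)[of n] by (auto simp: Inv_def V_def W_def case_prod_unfold)
  have N: "cl (V n) \<subseteq> V (Suc n)" "cl (W n) \<subseteq> W (Suc n)" for n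
    using f(2)[of n] by (auto simp: Nxt_def V_def W_def case_prod_unfold)
  have C: "d a b < inverse (Suc n)"
    if "connectedin mtopology T" "T \<inter> V (Suc n) = {}" "T \<inter> W (Suc n) = {}" "a \<in> T" "b \<in> T" for n T a b
    using f(2)[of n] that unfolding Nxt_def V_def W_def case_prod_unfold by blast
  have mono: "mono V" "mono W"
    unfolding mono_iff_le_Suc using order_trans[OF sub[OF I(1)] N(1)] order_trans[OF sub[OF I(2)] N(2)] by blast+
  have dVW: "disjnt (V m) (W n)" for m n
  proof -
    have "V m \<subseteq> V (max m n)" "W n \<subseteq> W (max m n)"
      using mono by (simp_all add: monoD)
    then show ?thesis
      using I(3)[of "max m n"] sub[OF I(1)[of "max m n"]] sub[OF I(2)[of "max m n"]]
      unfolding disjnt_iff by blast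
  qed
  show ?thesis
  proof
    show "openin mtopology (\<Union>n. V n)" "openin mtopology (\<Union>n. W n)" using I(1,2) by auto
    show "disjnt (\<Union>n. V n) (\<Union>n. W n)" using dVW by (auto simp: disjnt_iff)
    show "A \<subseteq> (\<Union>n. V n)" "B \<subseteq> (\<Union>n. W n)" using I(4,5)[of 0] by auto
    fix T a b
    assume T: "connectedin mtopology T" "T \<inter> (\<Union>n. V n) = {}" "T \<inter> (\<Union>n. W n) = {}" "a \<in> T" "b \<in> T"
    have "d a b < inverse (Suc n)" for n
    proof (rule C[OF T(1) _ _ T(4,5)])
      have "V (Suc n) \<subseteq> (\<Union>n. V n)" "W (Suc n) \<subseteq> (\<Union>n. W n)" by blast+
      then show "T \<inter> V (Suc n) = {}" "T \<inter> W (Suc n) = {}" using T(2,3) by (meson disjoint_iff subsetD)+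
    qed
    then have "\<not> d a b > 0"
      by (metis not_less_iff_gr_or_eq reals_Archimedean)
    moreover have "a \<in> M" "b \<in> M" using T connectedin_subset_topspace by fastforce+
    ultimately show "a = b" by (meson mdist_pos_less)
  qed
qed

text \<open>The complement of the component of \<open>F -` (V \<union> W)\<close> containing \<open>N\<close> falls into components with
  connected frontiers, which \<open>F\<close> has to map to single points.\<close>
lemma push_off_partition:
  fixes F :: "'n::euclidean_space \<Rightarrow> 'b"
  assumes F: "continuous_map euclidean Y F"
    and VW: "openin Y V" "openin Y W" "disjnt V W"
    and pt: "\<And>T a b. \<lbrakk>connectedin Y T; T \<inter> V = {}; T \<inter> W = {}; a \<in> T; b \<in> T\<rbrakk> \<Longrightarrow> a = b"
    and N: "connected N" "N \<noteq> {}" "F ` N \<subseteq> V"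
  obtains F' where "continuous_map euclidean Y F'" "\<And>z. z \<in> N \<Longrightarrow> F' z = F z" "range F' \<inter> W = {}"
proof -
  define K where "K = {z. F z \<notin> V \<union> W}"
  have opV: "open {z. F z \<in> U}" if "openin Y U" for U
    using openin_continuous_map_preimage[OF F that] by simp
  have "open {z. F z \<in> V \<union> W}" using opV VW by blast
  moreover have "- K = {z. F z \<in> V \<union> W}" by (auto simp: K_def)
  ultimately have clK: "closed K" by (simp add: closed_def)
  obtain n0 where n0: "n0 \<in> N" using N by blast
  \<comment> \<open>A whole component of \<open>- K\<close> has its frontier in \<open>K\<close>,
    and its connected image cannot leave the side \<open>V\<close> on which \<open>N\<close>
    starts.\<close>
  define C where "C = connected_component_set (-K) n0"
  have NC: "N \<subseteq> C"
    unfolding C_def using N n0 VW by (intro connected_component_maximal) (auto simp: K_def)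
  have opC: "open C" unfolding C_def using clK by (intro open_connected_component open_Compl)
  have connC: "connected C" unfolding C_def by simp
  have frC: "frontier C \<subseteq> K"
    unfolding C_def using clK frontier_of_connected_component_subset[of "-K" n0] frontier_subset_eq
    by (metis frontier_complement order_trans)
  have CK: "C \<subseteq> -K" unfolding C_def by (rule connected_component_subset)
  have CV: "F ` C \<subseteq> V"
  proof -
    have "connectedin Y (F ` C)"
      using connectedin_continuous_map_image[OF F] connC by auto
    moreover have "F ` C \<subseteq> V \<union> W" using CK by (auto simp: K_def)
    moreover have "V \<inter> F ` C \<noteq> {}" using n0 NC N by blast
    moreover have "V \<inter> W \<inter> F ` C = {}" using VW by (auto simp: disjnt_iff)
    ultimately have "W \<inter> F ` C = {}"
      using VW unfolding connectedin by blast
    then show ?thesis using \<open>F ` C \<subseteq> V \<union> W\<close> by blast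
  qed
  define E where "E z = connected_component_set (-C) z" for z
  have Ecomp: "E z \<in> components (-C)" if "z \<notin> C" for z
    using that by (auto simp: E_def components_def)
  have Eself: "z \<in> E z" if "z \<notin> C" for z using that by (simp add: E_def)
  have frE: "frontier (E z) \<subseteq> K" if "z \<notin> C" for z
    using frontier_of_components_subset[OF Ecomp[OF that]] frC by (metis frontier_complement order_trans)
  have const: "F a = F b" if "z \<notin> C" "a \<in> frontier (E z)" "b \<in> frontier (E z)" for z a b
  proof (rule pt)
    have "connected (frontier (E z))"
      by (rule connected_frontier_component_complement[OF connC Ecomp[OF that(1)]])
    then show "connectedin Y (F ` frontier (E z))"
      using connectedin_continuous_map_image[OF F] by auto
  qed (use that frE[OF that(1)] in \<open>auto simp: K_def\<close>)
  \<comment> \<open>By \<open>const\<close> the choice is immaterial. A frontier point exists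
    because \<open>E z\<close> is nonempty and misses the nonempty set \<open>C\<close>; it lies in
    \<open>K\<close>, so its value under \<open>F\<close> avoids \<open>W\<close>.\<close>
  define b where "b z = (SOME w. w \<in> frontier (E z))" for z
  have b: "b z \<in> frontier (E z)" if "z \<notin> C" for z
  proof -
    have "E z \<noteq> UNIV"
      using NC n0 connected_component_subset[of "-C" z] by (auto simp: E_def)
    then have "frontier (E z) \<noteq> {}"
      using Eself[OF that] by (metis empty_iff frontier_eq_empty)
    then show ?thesis unfolding b_def by (simp add: some_in_eq)
  qed
  define F' where "F' z = (if z \<in> C then F z else F (b z))" for z
  have F'fr: "F' z = F w" if "z \<notin> C" "w \<in> frontier (E z)" for z w
    using const[OF that(1) b[OF that(1)] that(2)] that by (simp add: F'_def)
  have Eeq: "E w = E z" if "w \<in> E z" for w z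
    using that unfolding E_def by (metis connected_component_eq)
  have FY: "F z \<in> topspace Y" for z using F by (auto simp: continuous_map_def)
  show ?thesis
  proof
    show "F' z = F z" if "z \<in> N" for z using that NC by (auto simp: F'_def)
    show "range F' \<inter> W = {}"
    proof -
      have "F' z \<notin> W" for z
        using CV VW b[of z] frE[of z] by (auto simp: F'_def disjnt_iff K_def)
      then show ?thesis by blast
    qed
    show "continuous_map euclidean Y F'"
      unfolding continuous_map_eq_topcontinuous_at
    proof
      fix z :: 'n
      have "\<exists>U. open U \<and> z \<in> U \<and> (\<forall>y\<in>U. F' y \<in> Q)" if Q: "openin Y Q" "F' z \<in> Q" for Q
      proof (cases "z \<in> C")
        case True
        show ?thesis
          using True opC opV[OF Q(1)] Q by (intro exI[of _ "C \<inter> {z. F z \<in> Q}"]) (auto simp: F'_def)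
      next
        case zC: False
        show ?thesis
        proof (cases "z \<in> interior (E z)")
          case True
          have "F' y = F' z" if "y \<in> interior (E z)" for y
          proof -
            have "y \<in> E z" using that interior_subset by blast
            moreover from this have "y \<notin> C" using connected_component_subset[of "-C" z] by (auto simp: E_def)
            ultimately show ?thesis using Eeq[of y z] F'fr[of y "b z"] F'fr[of z "b z"] b[OF zC] zC by simp
          qed
          then have "\<forall>y\<in>interior (E z). F' y \<in> Q" using Q(2) by metis
          then show ?thesis using True open_interior by blast
        next
          case False
          then have zfr: "z \<in> frontier (E z)"
            using Eself[OF zC] by (simp add: frontier_def closure_def)
          then have FQ: "F z \<in> Q" using F'fr[OF zC] Q by simp
          then obtain r where r: "r > 0" "ball z r \<subseteq> {z. F z \<in> Q}"
            using opV[OF Q(1)] by (meson mem_Collect_eq open_contains_ball)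
          have "F' y \<in> Q" if y: "y \<in> ball z r" for y
          proof (cases "y \<in> C")
            case True then show ?thesis using y r by (auto simp: F'_def)
          next
            case yC: False
            show ?thesis
            proof (cases "z \<in> E y")
              case True
              then have "E z = E y" by (rule Eeq)
              then show ?thesis using F'fr[OF yC, of z] zfr FQ by simp
            next
              case False
              \<comment> \<open>Infinitely many components may accumulate at \<open>z\<close>. The
                segment leaves \<open>E y\<close> inside the convex ball, and \<open>F' y\<close> is
                the value of \<open>F\<close> at the exit point, so it is controlled by
                \<open>F\<close> near \<open>z\<close>.\<close>
              have "closed_segment y z \<inter> frontier (E y) \<noteq> {}"
                using Eself[OF yC] False by (intro connected_Int_frontier) auto
              then obtain w where w: "w \<in> closed_segment y z" "w \<in> frontier (E y)" by blast
              have "closed_segment y z \<subseteq> ball z r"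
                using y r by (intro closed_segment_subset) auto
              then show ?thesis using w r F'fr[OF yC w(2)] by auto
            qed
          qed
          then show ?thesis using r by (intro exI[of _ "ball z r"]) auto
        qed
      qed
      then show "topcontinuous_at euclidean Y F' z"
        using FY by (auto simp: topcontinuous_at_def F'_def)
    qed
  qed
qed

section \<open>Homotopies of loops\<close>

abbreviation loop_homotopic :: "'a topology \<Rightarrow> 'a \<Rightarrow> (real \<Rightarrow> 'a) \<Rightarrow> (real \<Rightarrow> 'a) \<Rightarrow> bool" where
  "loop_homotopic X x \<equiv> homotopic_with (\<lambda>r. r 0 = x \<and> r 1 = x) (top_of_set {0..1}) X"

lemma prod_topology_unit_interval:
  "prod_topology (top_of_set {0..1::real}) (top_of_set {0..1::real}) = top_of_set ({0..1} \<times> {0..1})"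
  by (simp add: subtopology_Times euclidean_product_topology)

lemma loop_homotopicE:
  assumes "loop_homotopic X x p q"
  obtains H where "continuous_map (top_of_set ({0..1::real} \<times> {0..1::real})) X H"
    "\<forall>t. H (0,t) = p t" "\<forall>t. H (1,t) = q t" "\<forall>s\<in>{0..1}. H (s,0) = x \<and> H (s,1) = x"
proof -
  obtain h where h: "continuous_map (top_of_set ({0..1::real} \<times> {0..1::real})) X h \<and> (\<forall>t. h (0,t) = p t) \<and>
      (\<forall>t. h (1,t) = q t) \<and> (\<forall>s\<in>{0..1}. h (s,0) = x \<and> h (s,1) = x)"
    using assms unfolding homotopic_with_def prod_topology_unit_interval by (rule exE)
  show ?thesis
    by (rule that[of h]) (use h in simp_all)
qed

text \<open>\<open>homotopic_with\<close> prescribes the two ends of the homotopy at all reals. The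
  condition on loops depends only on the values at \<open>0\<close> and \<open>1\<close>, so
  agreement on the unit interval is enough.\<close>

lemma loop_homotopicI:
  assumes "continuous_map (top_of_set ({0..1::real} \<times> {0..1::real})) X H"
    and "\<And>t. t \<in> {0..1} \<Longrightarrow> H (0,t) = p t" "\<And>t. t \<in> {0..1} \<Longrightarrow> H (1,t) = q t"
    and "\<And>s. s \<in> {0..1} \<Longrightarrow> H (s,0) = x" "\<And>s. s \<in> {0..1} \<Longrightarrow> H (s,1) = x"
  shows "loop_homotopic X x p q"
proof (subst homotopic_with)
  show "\<exists>h. continuous_map (prod_topology (top_of_set {0..1::real}) (top_of_set {0..1})) X h \<and>
      (\<forall>t\<in>topspace (top_of_set {0..1}). h (0,t) = p t) \<and>
      (\<forall>t\<in>topspace (top_of_set {0..1}). h (1,t) = q t) \<and>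
      (\<forall>s\<in>{0..1}. h (s,0) = x \<and> h (s,1) = x)"
    unfolding prod_topology_unit_interval by (rule exI[of _ H]) (use assms in simp)
qed simp

text \<open>The closed ball of radius \<open>r\<close> and the complement of the open ball of radius
  \<open>2 * r\<close> are disjoint closed sets, so a totally disconnected partition separates them,
  and \<open>H\<close> can be pushed off the outer side without changing it on the boundary of the
  square. The new bound depends on the boundary values alone. The factor two only leaves room for
  the partition.\<close>

lemma (in Metric_space) shrink_square:
  assumes dim: "covering_dim_le mtopology 1" and r: "r > 0" and y: "y \<in> M"
    and H: "continuous_map (top_of_set ({0..1::real} \<times> {0..1::real})) mtopology H"
    and bd: "\<And>s t. \<lbrakk>s \<in> {0..1}; t \<in> {0..1}; s \<in> {0,1} \<or> t \<in> {0,1}\<rbrakk> \<Longrightarrow> d y (H (s,t)) \<le> r"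
  obtains H' where "continuous_map (top_of_set ({0..1} \<times> {0..1})) mtopology H'"
    "\<And>s t. \<lbrakk>s \<in> {0..1}; t \<in> {0..1}; s \<in> {0,1} \<or> t \<in> {0,1}\<rbrakk> \<Longrightarrow> H' (s,t) = H (s,t)"
    "\<And>s t. \<lbrakk>s \<in> {0..1}; t \<in> {0..1}\<rbrakk> \<Longrightarrow> d y (H' (s,t)) < 2 * r"
proof -
  have "closedin mtopology (M - mball y (2*r))" by (metis closedin_diff closedin_topspace openin_mball topspace_mtopology)
  moreover have "disjnt (mcball y r) (M - mball y (2*r))"
    using r by (auto simp: disjnt_iff)
  ultimately obtain V W where VW: "openin mtopology V" "openin mtopology W" "disjnt V W"
     "mcball y r \<subseteq> V" "M - mball y (2*r) \<subseteq> W"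
    and pt: "\<And>T a b. \<lbrakk>connectedin mtopology T; T \<inter> V = {}; T \<inter> W = {}; a \<in> T; b \<in> T\<rbrakk> \<Longrightarrow> a = b"
    using totally_disconnected_partition[OF dim, of "mcball y r" "M - mball y (2*r)"] by auto
  \<comment> \<open>Pushing off a partition is done on the whole plane. Clamping extends
    \<open>H\<close> so that the outside of the open square, a connected set, takes only values that
    \<open>H\<close> has on the boundary.\<close>
  define clamp where "clamp s = max 0 (min 1 s)" for s :: real
  define F where "F = H \<circ> (\<lambda>z. (clamp (fst z), clamp (snd z)))"
  have cl01: "clamp s \<in> {0..1}" for s by (auto simp: clamp_def)
  have clid: "clamp s = s" if "s \<in> {0..1}" for s using that by (auto simp: clamp_def)
  have HM: "H (s,t) \<in> M" if "s \<in> {0..1}" "t \<in> {0..1}" for s t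
    using H that by (auto simp: continuous_map_def Pi_iff)
  have F: "continuous_map euclidean mtopology F"
    unfolding F_def
  proof (rule continuous_map_compose[OF _ H])
    show "continuous_map euclidean (top_of_set ({0..1} \<times> {0..1})) (\<lambda>z. (clamp (fst z), clamp (snd z)))"
      using cl01 by (auto simp: continuous_map_in_subtopology clamp_def intro!: continuous_intros)
  qed
  define N where "N = - ({0<..<1::real} \<times> {0<..<1::real})"
  have Nb: "z \<in> N \<longleftrightarrow> fst z \<le> 0 \<or> fst z \<ge> 1 \<or> snd z \<le> 0 \<or> snd z \<ge> 1" for z
    by (cases z) (auto simp: N_def not_less)
  have N1: "connected N"
    unfolding N_def by (rule connected_complement_bounded_convex) (auto intro: bounded_Times convex_Times)
  have N2: "N \<noteq> {}" using Nb[of "(0,0)"] by auto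
  have N3: "F ` N \<subseteq> V"
  proof
    fix w assume "w \<in> F ` N"
    then obtain z where z: "z \<in> N" "w = H (clamp (fst z), clamp (snd z))" by (auto simp: F_def)
    then have "clamp (fst z) \<in> {0,1} \<or> clamp (snd z) \<in> {0,1}"
      using Nb[of z] by (auto simp: clamp_def)
    then have "d y w \<le> r" using bd cl01 z by blast
    then show "w \<in> V" using VW(4) HM cl01 z y by (auto simp: subset_eq)
  qed
  obtain F' where F': "continuous_map euclidean mtopology F'"
    "\<And>z. z \<in> N \<Longrightarrow> F' z = F z" "range F' \<inter> W = {}"
    by (rule push_off_partition[OF F VW(1-3) _ N1 N2 N3]) (erule (4) pt, blast)
  show ?thesis
  proof
    show "continuous_map (top_of_set ({0..1} \<times> {0..1})) mtopology F'"
      using F'(1) by (rule continuous_map_from_subtopology)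
    show "F' (s,t) = H (s,t)" if "s \<in> {0..1}" "t \<in> {0..1}" "s \<in> {0,1} \<or> t \<in> {0,1}" for s t
    proof -
      have "(s,t) \<in> N" using that Nb[of "(s,t)"] by auto
      then show ?thesis using F'(2)[of "(s,t)"] that by (simp add: F_def clid)
    qed
    show "d y (F' (s,t)) < 2 * r" for s t
    proof -
      have "F' (s,t) \<in> M" using F'(1) by (auto simp: continuous_map_def)
      moreover have "F' (s,t) \<notin> W" using F'(3) by blast
      ultimately have "F' (s,t) \<in> mball y (2*r)" using VW(5) by blast
      then show ?thesis by simp
    qed
  qed
qed

text \<open>\<open>P\<close> and \<open>Q\<close> are infinite concatenations of loops at \<open>y\<close>, one for each component \<open>{a<..<b}\<close> of
  \<open>G\<close>. Pasting the homotopies between these loops yields a continuous map since those for short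
  components can be chosen close to \<open>y\<close>.\<close>
lemma (in Metric_space) homotopic_infinite_concatenation:
  fixes P Q :: "real \<Rightarrow> 'a"
  assumes dim: "covering_dim_le mtopology 1"
    and P: "pathin mtopology P" and Q: "pathin mtopology Q"
    and G: "open G" "G \<subseteq> {0<..<1}"
    and y: "\<And>t. \<lbrakk>t \<in> {0..1}; t \<notin> G\<rbrakk> \<Longrightarrow> P t = y \<and> Q t = y"
    and gap: "\<And>a b. \<lbrakk>0 \<le> a; a < b; b \<le> 1; a \<notin> G; b \<notin> G; {a<..<b} \<subseteq> G\<rbrakk> \<Longrightarrow>
       loop_homotopic mtopology y (\<lambda>t. P (a + (b - a) * t)) (\<lambda>t. Q (a + (b - a) * t))"
  shows "loop_homotopic mtopology y P Q"
proof -
  define m where "m t = d y (P t) + d y (Q t)" for t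
  have PQM: "P t \<in> M" "Q t \<in> M" if "t \<in> {0..1}" for t
    using P Q that by (auto simp: pathin_def continuous_map_def)
  have ym: "y \<in> M" using y[of 0] PQM[of 0] G by force
  have m0: "m t = 0" if "t \<in> {0..1}" "t \<notin> G" for t
    using y[OF that] ym by (simp add: m_def)
  have cm: "continuous_on {0..1} m"
  proof -
    have "continuous_map (top_of_set {0..1}) euclideanreal m"
      unfolding m_def using P Q ym
        continuous_map_mdist[of "top_of_set {0..1}" "Self" "\<lambda>_. y"]
      by (intro continuous_map_add) (auto simp: pathin_def mtopology_of_def)
    then show ?thesis by simp
  qed
  define gp where "gp = (\<lambda>(a,b). 0 \<le> a \<and> a < b \<and> b \<le> 1 \<and> a \<notin> G \<and> b \<notin> G \<and> {a<..<b} \<subseteq> G)"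
  \<comment> \<open>The supremum bounds both paths on the interval. The term \<open>b - a\<close>
    keeps the radius positive even where both paths rest at \<open>y\<close>, as
    \<open>shrink_square\<close> demands.\<close>
  define \<rho> where "\<rho> a b = b - a + Sup (m ` {a..b})" for a b
  have bdm: "bdd_above (m ` {a..b})" if "0 \<le> a" "b \<le> 1" for a b
    using that cm by (intro bounded_imp_bdd_above compact_imp_bounded compact_continuous_image)
      (auto intro: continuous_on_subset)
  define hty where "hty a b K \<longleftrightarrow> continuous_map (top_of_set ({0..1::real} \<times> {a..b})) mtopology K \<and>
       (\<forall>t\<in>{a..b}. K (0,t) = P t \<and> K (1,t) = Q t) \<and>
       (\<forall>s\<in>{0..1}. K (s,a) = y \<and> K (s,b) = y) \<and>
       (\<forall>s\<in>{0..1}. \<forall>t\<in>{a..b}. d y (K (s,t)) < 2 * \<rho> a b)" for a b K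
  have "\<exists>K. hty a b K" if g: "gp (a,b)" for a b
  proof -
    have ab: "0 \<le> a" "a < b" "b \<le> 1" "a \<notin> G" "b \<notin> G" "{a<..<b} \<subseteq> G"
      using g by (auto simp: gp_def)
    obtain H where H: "continuous_map (top_of_set ({0..1::real} \<times> {0..1::real})) mtopology H"
      "\<forall>t. H (0,t) = P (a + (b - a) * t)" "\<forall>t. H (1,t) = Q (a + (b - a) * t)"
      "\<forall>s\<in>{0..1}. H (s,0) = y \<and> H (s,1) = y"
      by (rule loop_homotopicE[OF gap[OF ab]])
    have aff: "a + (b - a) * t \<in> {a..b}" if "t \<in> {0..1}" for t
    proof -
      have "(b - a) * t \<le> (b - a) * 1" using that ab by (intro mult_left_mono) auto
      moreover have "(b - a) * t \<ge> 0" using that ab by simp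
      ultimately show ?thesis by simp
    qed
    have mle: "m t \<le> \<rho> a b" if "t \<in> {a..b}" for t
      using cSUP_upper[OF that bdm[OF ab(1,3)]] ab by (simp add: \<rho>_def)
    have "Sup (m ` {a..b}) \<ge> 0"
      using cSUP_upper[of a, OF _ bdm[OF ab(1,3)]] ab m0[of a] by auto
    then have \<rho>0: "\<rho> a b > 0" using ab by (simp add: \<rho>_def)
    have "d y (H (s,t)) \<le> \<rho> a b" if "s \<in> {0..1}" "t \<in> {0..1}" "s \<in> {0,1} \<or> t \<in> {0,1}" for s t
    proof -
      have "d y (P (a + (b - a) * t)) \<le> m (a + (b - a) * t)" "d y (Q (a + (b - a) * t)) \<le> m (a + (b - a) * t)"
        by (auto simp: m_def)
      then show ?thesis using that(1,3) H(2-4) mle[OF aff[OF that(2)]] \<rho>0 ym by force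
    qed
    then obtain H' where H': "continuous_map (top_of_set ({0..1} \<times> {0..1})) mtopology H'"
      "\<And>s t. \<lbrakk>s \<in> {0..1}; t \<in> {0..1}; s \<in> {0,1} \<or> t \<in> {0,1}\<rbrakk> \<Longrightarrow> H' (s,t) = H (s,t)"
      "\<And>s t. \<lbrakk>s \<in> {0..1}; t \<in> {0..1}\<rbrakk> \<Longrightarrow> d y (H' (s,t)) < 2 * \<rho> a b"
      using shrink_square[OF dim \<rho>0 ym H(1)] by metis
    define \<phi> where "\<phi> t = (t - a) / (b - a)" for t
    have \<phi>: "\<phi> t \<in> {0..1}" "a + (b - a) * \<phi> t = t" if "t \<in> {a..b}" for t
      using that ab by (auto simp: \<phi>_def divide_simps)
    define K where "K = H' \<circ> (\<lambda>z. (fst z, \<phi> (snd z)))"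
    show ?thesis
      unfolding hty_def
    proof (intro exI[of _ K] conjI ballI)
      show "continuous_map (top_of_set ({0..1} \<times> {a..b})) mtopology K"
        unfolding K_def
      proof (rule continuous_map_compose[OF _ H'(1)])
        show "continuous_map (top_of_set ({0..1} \<times> {a..b})) (top_of_set ({0..1} \<times> {0..1})) (\<lambda>z. (fst z, \<phi> (snd z)))"
          using \<phi>(1) ab by (auto simp: continuous_map_in_subtopology \<phi>_def intro!: continuous_intros)
      qed
    next
      fix t assume t: "t \<in> {a..b}"
      show "K (0,t) = P t" "K (1,t) = Q t"
        using H'(2)[of _ "\<phi> t"] \<phi>[OF t] H(2,3) by (auto simp: K_def)
      fix s :: real assume "s \<in> {0..1}"
      then show "d y (K (s,t)) < 2 * \<rho> a b" using H'(3) \<phi>[OF t] by (auto simp: K_def)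
    next
      fix s :: real assume s: "s \<in> {0..1}"
      have "\<phi> a = 0" "\<phi> b = 1" using ab by (auto simp: \<phi>_def)
      then show "K (s,a) = y" "K (s,b) = y" using H'(2)[OF s] H(4) s by (auto simp: K_def)
    qed
  qed
  then obtain K where "\<And>a b. gp (a,b) \<Longrightarrow> hty a b (K a b)"
    by metis
  then have K: "\<And>a b. gp (a,b) \<Longrightarrow> continuous_map (top_of_set ({0..1} \<times> {a..b})) mtopology (K a b)"
    "\<And>a b t. \<lbrakk>gp (a,b); t \<in> {a..b}\<rbrakk> \<Longrightarrow> K a b (0,t) = P t \<and> K a b (1,t) = Q t"
    "\<And>a b s. \<lbrakk>gp (a,b); s \<in> {0..1}\<rbrakk> \<Longrightarrow> K a b (s,a) = y \<and> K a b (s,b) = y"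
    "\<And>a b s t. \<lbrakk>gp (a,b); s \<in> {0..1}; t \<in> {a..b}\<rbrakk> \<Longrightarrow> d y (K a b (s,t)) < 2 * \<rho> a b"
    unfolding hty_def by blast+
  have KM: "K a b (s,t) \<in> M" if "gp (a,b)" "s \<in> {0..1}" "t \<in> {a..b}" for a b s t
    using K(1)[OF that(1)] that by (auto simp: continuous_map_def Pi_iff)
  have ex: "\<exists>a b. gp (a,b) \<and> t \<in> {a<..<b}" if t: "t \<in> G" for t
  proof -
    have t01: "0 < t" "t < 1" using t G by auto
    \<comment> \<open>The component of \<open>G\<close> around \<open>t\<close> ends at the nearest
      points outside \<open>G\<close> on either side; they exist because the complement of
      \<open>G\<close> is closed and contains \<open>0\<close> and \<open>1\<close>.\<close>
    define a where "a = Sup ({0..t} - G)"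
    define b where "b = Inf ({t..1} - G)"
    have c1: "closed ({0..t} - G)" "closed ({t..1} - G)" using G by (auto intro: closed_Diff)
    have n1: "0 \<in> {0..t} - G" "1 \<in> {t..1} - G" using G t01 by auto
    have a: "a \<in> {0..t} - G" unfolding a_def
      using c1 n1 by (intro closed_contains_Sup) (auto simp: bdd_above_def)
    have b: "b \<in> {t..1} - G" unfolding b_def
      using c1 n1 by (intro closed_contains_Inf) (auto simp: bdd_below_def)
    have "a \<noteq> t" "b \<noteq> t" using a b t by auto
    then have atb: "a < t" "t < b" using a b by auto
    have "{a<..<b} \<subseteq> G"
    proof
      fix u assume u: "u \<in> {a<..<b}"
      show "u \<in> G"
      proof (rule ccontr)
        assume "u \<notin> G"
        then consider "u \<in> {0..t} - G" | "u \<in> {t..1} - G" using u a b by fastforce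
        then show False
        proof cases
          case 1 then have "u \<le> a" unfolding a_def by (intro cSup_upper) (auto simp: bdd_above_def)
          then show False using u by auto
        next
          case 2 then have "b \<le> u" unfolding b_def by (intro cInf_lower) (auto simp: bdd_below_def)
          then show False using u by auto
        qed
      qed
    qed
    then have "gp (a,b)" using a b atb by (auto simp: gp_def)
    then show ?thesis using atb by auto
  qed
  have uniq: "a = a' \<and> b = b'" if "gp (a,b)" "gp (a',b')" "t \<in> {a<..<b}" "t \<in> {a'<..<b'}" for a b a' b' t
  proof -
    have *: "\<not> a < a'" "\<not> a' < a" "\<not> b < b'" "\<not> b' < b"
      using that unfolding gp_def by (auto simp: subset_eq)
    then show ?thesis by auto
  qed
  define L where "L t = (THE ab. gp ab \<and> t \<in> {fst ab<..<snd ab})" for t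
  have L: "L t = (a,b)" if "gp (a,b)" "t \<in> {a<..<b}" for a b t
    unfolding L_def using that uniq by (intro the_equality) (auto dest: uniq)
  \<comment> \<open>Off \<open>G\<close> the three cases all give \<open>y\<close> as long as
    \<open>t\<close> is in the unit interval; separating them makes the conditions at
    \<open>s = 0\<close> and \<open>s = 1\<close> hold there by definition.\<close>
  define H where "H = (\<lambda>(s,t). if t \<in> G then K (fst (L t)) (snd (L t)) (s,t) else if s = 0 then P t else if s = 1 then Q t else y)"
  have Hgap: "H (s,t) = K a b (s,t)" if "gp (a,b)" "t \<in> {a..b}" "s \<in> {0..1}" for a b s t
  proof (cases "t \<in> {a<..<b}")
    case True
    then have "t \<in> G" using that by (auto simp: gp_def)
    then show ?thesis using L[OF that(1) True] by (simp add: H_def)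
  next
    case False
    then have "t = a \<or> t = b" using that by auto
    then show ?thesis using that K(3)[OF that(1,3)] y[of t] by (auto simp: H_def gp_def)
  qed
  have Hy: "H (s,t) = y" if "t \<in> {0..1}" "t \<notin> G" for s t
    using that y by (auto simp: H_def)
  have HM: "H (s,t) \<in> M" if "s \<in> {0..1}" "t \<in> {0..1}" for s t
  proof (cases "t \<in> G")
    case True
    then obtain a b where "gp (a,b)" "t \<in> {a<..<b}" using ex by blast
    then show ?thesis using Hgap[of a b t s] KM[of a b s t] that by auto
  qed (use Hy that ym in auto)
  have small: "\<exists>\<delta>>0. \<forall>a b s t. gp (a,b) \<and> b - a < \<delta> \<and> s \<in> {0..1} \<and> t \<in> {a..b} \<longrightarrow> d y (H (s,t)) < \<epsilon>"
    if e: "\<epsilon> > 0" for \<epsilon>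
  proof -
    \<comment> \<open>\<open>m\<close> vanishes at the left end \<open>a\<close>, so its supremum
      over a short interval is at most \<open>\<epsilon>/4\<close>. With
      \<open>b - a < \<epsilon>/4\<close> this gives
      \<open>2 * \<rho> a b < \<epsilon>\<close>.\<close>
    have "uniformly_continuous_on {0..1} m"
      using cm by (intro compact_uniformly_continuous) auto
    then obtain \<delta> where \<delta>: "\<delta> > 0" "\<And>u v. \<lbrakk>u \<in> {0..1}; v \<in> {0..1}; dist v u < \<delta>\<rbrakk> \<Longrightarrow> dist (m v) (m u) < \<epsilon>/4"
      unfolding uniformly_continuous_on_def using e by (metis zero_less_divide_iff zero_less_numeral)
    have "d y (H (s,t)) < \<epsilon>"
      if g: "gp (a,b)" "b - a < min \<delta> (\<epsilon>/4)" "s \<in> {0..1}" "t \<in> {a..b}" for a b s t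
    proof -
      have ab: "0 \<le> a" "a < b" "b \<le> 1" "a \<notin> G" using g by (auto simp: gp_def)
      have "m u \<le> \<epsilon>/4" if "u \<in> {a..b}" for u
        using \<delta>(2)[of a u] that ab g m0[of a] by (auto simp: dist_real_def)
      then have "Sup (m ` {a..b}) \<le> \<epsilon>/4" using ab by (intro cSUP_least) auto
      then have "2 * \<rho> a b < \<epsilon>" using g by (auto simp: \<rho>_def)
      then show ?thesis using K(4)[OF g(1,3,4)] Hgap[OF g(1,4,3)] by simp
    qed
    then show ?thesis using \<delta> e by (intro exI[of _ "min \<delta> (\<epsilon>/4)"]) auto
  qed
  have Kball: "\<exists>\<eta>>0. \<forall>s'\<in>{0..1}. \<forall>t'\<in>{a..b}. \<bar>s' - s\<bar> < \<eta> \<and> \<bar>t' - t\<bar> < \<eta> \<longrightarrow> H (s',t') \<in> U"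
    if "gp (a,b)" "s \<in> {0..1}" "t \<in> {a..b}" "openin mtopology U" "H (s,t) \<in> U" for a b s t U
  proof -
    have "openin (top_of_set ({0..1} \<times> {a..b})) {z \<in> {0..1} \<times> {a..b}. K a b z \<in> U}"
      using openin_continuous_map_preimage[OF K(1)[OF that(1)] that(4)] by simp
    moreover have "(s,t) \<in> {z \<in> {0..1} \<times> {a..b}. K a b z \<in> U}"
      using that Hgap[OF that(1,3,2)] by auto
    ultimately obtain e where e: "e > 0"
      "ball (s,t) e \<inter> ({0..1} \<times> {a..b}) \<subseteq> {z \<in> {0..1} \<times> {a..b}. K a b z \<in> U}"
      unfolding openin_contains_ball by blast
    have "H (s',t') \<in> U" if "s' \<in> {0..1}" "t' \<in> {a..b}" "\<bar>s' - s\<bar> < e/2" "\<bar>t' - t\<bar> < e/2" for s' t'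
    proof -
      have "dist (s,t) (s',t') \<le> \<bar>s' - s\<bar> + \<bar>t' - t\<bar>"
        using sqrt_sum_squares_le_sum_abs[of "s - s'" "t - t'"]
        by (simp add: dist_Pair_Pair dist_real_def abs_minus_commute power2_commute)
      then have "(s',t') \<in> ball (s,t) e" using that by auto
      then show ?thesis using e that Hgap[OF \<open>gp (a,b)\<close> that(2,1)] by auto
    qed
    then show ?thesis using e(1) by (intro exI[of _ "e/2"]) auto
  qed
  \<comment> \<open>Either a component of \<open>G\<close> begins at \<open>t\<close>, and the
    homotopy over it is continuous up to this end; or points \<open>c\<close> outside
    \<open>G\<close> come arbitrarily close to \<open>t\<close> from the right. Then every component
    between \<open>t\<close> and a near \<open>c\<close> is short, and \<open>small\<close> bounds
    all of them at once.\<close>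
  have right: "\<exists>\<eta>>0. \<forall>s'\<in>{0..1}. \<forall>t'\<in>{0..1}. \<bar>s' - s\<bar> < \<eta> \<and> t \<le> t' \<and> t' < t + \<eta> \<longrightarrow> d y (H (s',t')) < \<epsilon>"
    if t: "t \<in> {0..1}" "t \<notin> G" and s: "s \<in> {0..1}" and e: "\<epsilon> > 0" for s t \<epsilon>
  proof (cases "\<exists>b. gp (t,b)")
    case True
    then obtain b where b: "gp (t,b)" by blast
    then have tb: "t < b" by (auto simp: gp_def)
    obtain \<eta> where \<eta>: "\<eta> > 0" "\<forall>s'\<in>{0..1}. \<forall>t'\<in>{t..b}. \<bar>s' - s\<bar> < \<eta> \<and> \<bar>t' - t\<bar> < \<eta> \<longrightarrow> H (s',t') \<in> mball y \<epsilon>"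
      using Kball[OF b s, of t "mball y \<epsilon>"] tb Hy[OF t, of s] ym e by auto
    then show ?thesis using tb by (intro exI[of _ "min \<eta> (b - t)"]) auto
  next
    case False
    obtain \<delta> where \<delta>: "\<delta> > 0"
      "\<And>a b s t. \<lbrakk>gp (a,b); b - a < \<delta>; s \<in> {0..1}; t \<in> {a..b}\<rbrakk> \<Longrightarrow> d y (H (s,t)) < \<epsilon>"
      using small[OF e] by blast
    have "\<exists>c. t < c \<and> c < t + \<delta> \<and> c \<notin> G"
    proof (rule ccontr)
      assume "\<not> ?thesis"
      then have *: "{t<..<t+\<delta>} \<subseteq> G" by auto
      then have "t + \<delta>/2 \<in> G" using \<delta>(1) by auto
      then obtain a b where ab: "gp (a,b)" "t + \<delta>/2 \<in> {a<..<b}" using ex by blast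
      have "\<not> a < t" using ab t \<delta>(1) by (auto simp: gp_def subset_eq)
      moreover have "\<not> t < a" using ab \<delta>(1) * by (auto simp: gp_def subset_eq)
      ultimately have "a = t" by auto
      then show False using False ab by auto
    qed
    then obtain c where c: "t < c" "c < t + \<delta>" "c \<notin> G" by blast
    have "d y (H (s',t')) < \<epsilon>" if "s' \<in> {0..1}" "t' \<in> {0..1}" "t \<le> t'" "t' < c" for s' t'
    proof (cases "t' \<in> G")
      case True
      then obtain a b where ab: "gp (a,b)" "t' \<in> {a<..<b}" using ex by blast
      have "\<not> a < t" "\<not> c < b" using ab t c that by (auto simp: gp_def subset_eq)
      then show ?thesis using \<delta>(2)[OF ab(1), of s' t'] ab c that by auto
    qed (use Hy that ym e in auto)
    then show ?thesis using c by (intro exI[of _ "c - t"]) auto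
  qed
  have left: "\<exists>\<eta>>0. \<forall>s'\<in>{0..1}. \<forall>t'\<in>{0..1}. \<bar>s' - s\<bar> < \<eta> \<and> t' \<le> t \<and> t - \<eta> < t' \<longrightarrow> d y (H (s',t')) < \<epsilon>"
    if t: "t \<in> {0..1}" "t \<notin> G" and s: "s \<in> {0..1}" and e: "\<epsilon> > 0" for s t \<epsilon>
  proof (cases "\<exists>a. gp (a,t)")
    case True
    then obtain a where a: "gp (a,t)" by blast
    then have at: "a < t" by (auto simp: gp_def)
    obtain \<eta> where \<eta>: "\<eta> > 0" "\<forall>s'\<in>{0..1}. \<forall>t'\<in>{a..t}. \<bar>s' - s\<bar> < \<eta> \<and> \<bar>t' - t\<bar> < \<eta> \<longrightarrow> H (s',t') \<in> mball y \<epsilon>"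
      using Kball[OF a s, of t "mball y \<epsilon>"] at Hy[OF t, of s] ym e by auto
    then show ?thesis using at by (intro exI[of _ "min \<eta> (t - a)"]) auto
  next
    case False
    obtain \<delta> where \<delta>: "\<delta> > 0"
      "\<And>a b s t. \<lbrakk>gp (a,b); b - a < \<delta>; s \<in> {0..1}; t \<in> {a..b}\<rbrakk> \<Longrightarrow> d y (H (s,t)) < \<epsilon>"
      using small[OF e] by blast
    have "\<exists>c. c < t \<and> t - \<delta> < c \<and> c \<notin> G"
    proof (rule ccontr)
      assume "\<not> ?thesis"
      then have *: "{t-\<delta><..<t} \<subseteq> G" by auto
      then have "t - \<delta>/2 \<in> G" using \<delta>(1) by auto
      then obtain a b where ab: "gp (a,b)" "t - \<delta>/2 \<in> {a<..<b}" using ex by blast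
      have "\<not> t < b" using ab t \<delta>(1) by (auto simp: gp_def subset_eq)
      moreover have "\<not> b < t" using ab \<delta>(1) * by (auto simp: gp_def subset_eq)
      ultimately have "b = t" by auto
      then show False using False ab by auto
    qed
    then obtain c where c: "c < t" "t - \<delta> < c" "c \<notin> G" by blast
    have "d y (H (s',t')) < \<epsilon>" if "s' \<in> {0..1}" "t' \<in> {0..1}" "t' \<le> t" "c < t'" for s' t'
    proof (cases "t' \<in> G")
      case True
      then obtain a b where ab: "gp (a,b)" "t' \<in> {a<..<b}" using ex by blast
      have "\<not> t < b" "\<not> a < c" using ab t c that by (auto simp: gp_def subset_eq)
      then show ?thesis using \<delta>(2)[OF ab(1), of s' t'] ab c that by auto
    qed (use Hy that ym e in auto)
    then show ?thesis using c by (intro exI[of _ "t - c"]) auto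
  qed
  have loc: "\<exists>\<eta>>0. \<forall>s'\<in>{0..1}. \<forall>t'\<in>{0..1}. \<bar>s' - s\<bar> < \<eta> \<and> \<bar>t' - t\<bar> < \<eta> \<longrightarrow> H (s',t') \<in> U"
    if st: "s \<in> {0..1}" "t \<in> {0..1}" and U: "openin mtopology U" "H (s,t) \<in> U" for s t U
  proof (cases "t \<in> G")
    case True
    then obtain a b where ab: "gp (a,b)" "t \<in> {a<..<b}" using ex by blast
    then obtain \<eta> where \<eta>: "\<eta> > 0" "\<forall>s'\<in>{0..1}. \<forall>t'\<in>{a..b}. \<bar>s' - s\<bar> < \<eta> \<and> \<bar>t' - t\<bar> < \<eta> \<longrightarrow> H (s',t') \<in> U"
      using Kball[OF ab(1) st(1) _ U] by auto
    have "H (s',t') \<in> U"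
      if "s' \<in> {0..1}" "\<bar>s' - s\<bar> < min \<eta> (min (t - a) (b - t))" "\<bar>t' - t\<bar> < min \<eta> (min (t - a) (b - t))" for s' t'
    proof -
      have "t' \<in> {a..b}" using that(3) by auto
      then show ?thesis using \<eta>(2) that by auto
    qed
    then show ?thesis using \<eta>(1) ab by (intro exI[of _ "min \<eta> (min (t - a) (b - t))"]) auto
  next
    case False
    then have "y \<in> U" using U(2) Hy st by auto
    then obtain \<epsilon> where e: "\<epsilon> > 0" "mball y \<epsilon> \<subseteq> U" using U(1) unfolding openin_mtopology by blast
    obtain \<eta>1 where \<eta>1: "\<eta>1 > 0" "\<forall>s'\<in>{0..1}. \<forall>t'\<in>{0..1}. \<bar>s' - s\<bar> < \<eta>1 \<and> t \<le> t' \<and> t' < t + \<eta>1 \<longrightarrow> d y (H (s',t')) < \<epsilon>"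
      using right[OF st(2) False st(1) e(1)] by blast
    obtain \<eta>2 where \<eta>2: "\<eta>2 > 0" "\<forall>s'\<in>{0..1}. \<forall>t'\<in>{0..1}. \<bar>s' - s\<bar> < \<eta>2 \<and> t' \<le> t \<and> t - \<eta>2 < t' \<longrightarrow> d y (H (s',t')) < \<epsilon>"
      using left[OF st(2) False st(1) e(1)] by blast
    have "H (s',t') \<in> U" if "s' \<in> {0..1}" "t' \<in> {0..1}" "\<bar>s' - s\<bar> < min \<eta>1 \<eta>2" "\<bar>t' - t\<bar> < min \<eta>1 \<eta>2" for s' t'
    proof -
      have "d y (H (s',t')) < \<epsilon>"
        using \<eta>1(2)[rule_format, OF that(1,2)] \<eta>2(2)[rule_format, OF that(1,2)] that by linarith
      then show ?thesis using e(2) ym HM[OF that(1,2)] by auto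
    qed
    then show ?thesis using \<eta>1(1) \<eta>2(1) by (intro exI[of _ "min \<eta>1 \<eta>2"]) auto
  qed
  have "continuous_map (top_of_set ({0..1} \<times> {0..1})) mtopology H"
    unfolding continuous_map_eq_topcontinuous_at
  proof
    fix z :: "real \<times> real" assume z: "z \<in> topspace (top_of_set ({0..1} \<times> {0..1}))"
    obtain s t where zst: "z = (s,t)" by fastforce
    have st: "s \<in> {0..1}" "t \<in> {0..1}" using z zst by auto
    have "\<exists>V. openin (top_of_set ({0..1} \<times> {0..1})) V \<and> z \<in> V \<and> (\<forall>w\<in>V. H w \<in> U)"
      if U: "openin mtopology U" "H z \<in> U" for U
    proof -
      obtain \<eta> where \<eta>: "\<eta> > 0"
        "\<And>s' t'. \<lbrakk>s'\<in>{0..1}; t'\<in>{0..1}; \<bar>s' - s\<bar> < \<eta>; \<bar>t' - t\<bar> < \<eta>\<rbrakk> \<Longrightarrow> H (s',t') \<in> U"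
        using loc[OF st U(1)] U(2) zst by auto
      have "openin (top_of_set ({0..1} \<times> {0..1})) (({0..1} \<times> {0..1}) \<inter> (ball s \<eta> \<times> ball t \<eta>))"
        by (intro openin_open_Int open_Times open_ball)
      then show ?thesis using \<eta> st zst
        by (intro exI[of _ "({0..1} \<times> {0..1}) \<inter> (ball s \<eta> \<times> ball t \<eta>)"]) (auto simp: dist_real_def)
    qed
    then show "topcontinuous_at (top_of_set ({0..1} \<times> {0..1})) mtopology H z"
      using z HM by (auto simp: topcontinuous_at_def)
  qed
  moreover have "H (0,t) = P t" "H (1,t) = Q t" if "t \<in> {0..1}" for t
  proof -
    have "H (0,t) = P t \<and> H (1,t) = Q t"
    proof (cases "t \<in> G")
      case True
      then obtain a b where ab: "gp (a,b)" "t \<in> {a<..<b}" using ex by blast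
      then show ?thesis using Hgap[OF ab(1), of t] K(2)[OF ab(1), of t] by auto
    qed (simp add: H_def)
    then show "H (0,t) = P t" "H (1,t) = Q t" by auto
  qed
  moreover have "H (s,0) = y" "H (s,1) = y" for s
    using G(2) Hy[of 0 s] Hy[of 1 s] by force+
  ultimately show ?thesis
    by (rule loop_homotopicI)
qed

section \<open>Fundamental groups and induced maps\<close>

lemma loop_homotopic_refl: "p \<in> loops X x \<Longrightarrow> loop_homotopic X x p p"
  by (simp add: loops_def pathin_def)

lemma loop_homotopic_imp_loops:
  assumes "loop_homotopic X x p q"
  shows "p \<in> loops X x" "q \<in> loops X x"
  using homotopic_with_imp_continuous_maps[OF assms] homotopic_with_imp_property[OF assms]
  by (auto simp: loops_def pathin_def)

lemma mem_loop_class: "q \<in> loop_class X x p \<longleftrightarrow> loop_homotopic X x p q"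
  by (simp add: loop_class_def)

lemma loop_in_loop_class: "p \<in> loops X x \<Longrightarrow> p \<in> loop_class X x p"
  unfolding mem_loop_class by (rule loop_homotopic_refl)

lemma loop_class_eq_iff:
  assumes "p \<in> loops X x"
  shows "loop_class X x p = loop_class X x q \<longleftrightarrow> loop_homotopic X x p q"
proof
  assume eq: "loop_class X x p = loop_class X x q"
  have "p \<in> loop_class X x p"
    using assms by (rule loop_in_loop_class)
  then have "loop_homotopic X x q p"
    unfolding eq mem_loop_class .
  then show "loop_homotopic X x p q"
    by (rule homotopic_with_symD)
next
  assume pq: "loop_homotopic X x p q"
  show "loop_class X x p = loop_class X x q"
    unfolding loop_class_def
  proof (rule Collect_cong)
    show "loop_homotopic X x p r \<longleftrightarrow> loop_homotopic X x q r" for r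
      using homotopic_with_trans[OF pq] homotopic_with_trans[OF homotopic_with_symD[OF pq]] by blast
  qed
qed

lemma loop_homotopic_compose:
  assumes "f \<in> pointed_maps X x Y y" "loop_homotopic X x p q"
  shows "loop_homotopic Y y (f \<circ> p) (f \<circ> q)"
  using assms
  by (auto simp: pointed_maps_def intro!: homotopic_with_compose_continuous_map_left)

lemma loops_compose: "\<lbrakk>f \<in> pointed_maps X x Y y; p \<in> loops X x\<rbrakk> \<Longrightarrow> f \<circ> p \<in> loops Y y"
  by (auto simp: pointed_maps_def loops_def intro: pathin_compose)

lemma pointed_maps_compose:
  "\<lbrakk>f \<in> pointed_maps X x Y y; g \<in> pointed_maps Y y Z z\<rbrakk> \<Longrightarrow> g \<circ> f \<in> pointed_maps X x Z z"
  by (auto simp: pointed_maps_def intro: continuous_map_compose)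

lemma id_pointed_map: "id \<in> pointed_maps X x X x"
  by (simp add: pointed_maps_def)

lemma carrier_fundamental_group: "carrier (fundamental_group X x) = loop_class X x ` loops X x"
  by (simp add: fundamental_group_def)

lemma induced_hom_loop_class:
  assumes f: "f \<in> pointed_maps X x Y y" and p: "p \<in> loops X x"
  shows "induced_hom X x Y y f (loop_class X x p) = loop_class Y y (f \<circ> p)"
proof -
  have "loop_class Y y (f \<circ> q) = loop_class Y y (f \<circ> p)" if "q \<in> loop_class X x p" for q
    using loop_homotopic_compose[OF f that[unfolded mem_loop_class]]
    by (simp add: loop_class_eq_iff[OF loops_compose[OF f p], symmetric])
  moreover have "p \<in> loop_class X x p"
    using p by (rule loop_in_loop_class)
  ultimately have "(\<Union>q\<in>loop_class X x p. loop_class Y y (f \<circ> q)) = loop_class Y y (f \<circ> p)"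
    by blast
  then show ?thesis
    using p by (simp add: induced_hom_def carrier_fundamental_group)
qed

text \<open>Induced maps are extensional, so only classes of loops have to be compared. This turns
  uniqueness of a mediating morphism into a question about homotopies in \<open>Y\<close>.\<close>

lemma induced_hom_eq_iff:
  assumes f: "f \<in> pointed_maps X x Y y" and g: "g \<in> pointed_maps X x Y y"
  shows "induced_hom X x Y y f = induced_hom X x Y y g \<longleftrightarrow>
    (\<forall>p\<in>loops X x. loop_homotopic Y y (f \<circ> p) (g \<circ> p))"
proof -
  have "induced_hom X x Y y f = induced_hom X x Y y g \<longleftrightarrow>
      (\<forall>A \<in> carrier (fundamental_group X x). induced_hom X x Y y f A = induced_hom X x Y y g A)"
    by (auto simp: induced_hom_def fun_eq_iff restrict_def)
  also have "\<dots> \<longleftrightarrow> (\<forall>p\<in>loops X x. loop_class Y y (f \<circ> p) = loop_class Y y (g \<circ> p))"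
    using f g by (simp add: carrier_fundamental_group induced_hom_loop_class)
  finally show ?thesis
    using loop_class_eq_iff[OF loops_compose[OF f]] by simp
qed

lemma induced_hom_compose:
  assumes f: "f \<in> pointed_maps X x Y y" and g: "g \<in> pointed_maps Y y Z z"
  shows "compose (carrier (fundamental_group X x)) (induced_hom Y y Z z g) (induced_hom X x Y y f)
    = induced_hom X x Z z (g \<circ> f)"
proof
  fix A
  show "compose (carrier (fundamental_group X x)) (induced_hom Y y Z z g) (induced_hom X x Y y f) A
    = induced_hom X x Z z (g \<circ> f) A"
  proof (cases "A \<in> carrier (fundamental_group X x)")
    case True
    then obtain p where "A = loop_class X x p" "p \<in> loops X x"
      by (auto simp: carrier_fundamental_group)
    then show ?thesis
      using True f g by (simp add: compose_def induced_hom_loop_class loops_compose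
          pointed_maps_compose comp_assoc)
  next
    case False
    then show ?thesis by (simp add: compose_def induced_hom_def)
  qed
qed

lemma induced_hom_id:
  "induced_hom X x X x id = (\<lambda>A \<in> carrier (fundamental_group X x). A)"
proof
  fix A
  show "induced_hom X x X x id A = (\<lambda>A \<in> carrier (fundamental_group X x). A) A"
  proof (cases "A \<in> carrier (fundamental_group X x)")
    case True
    then show ?thesis
      by (auto simp: carrier_fundamental_group induced_hom_loop_class[OF id_pointed_map])
  qed (simp add: induced_hom_def)
qed

lemma pi_hom_compose:
  "\<lbrakk>u \<in> pi_hom X x Y y; v \<in> pi_hom Y y Z z\<rbrakk>
    \<Longrightarrow> compose (carrier (fundamental_group X x)) v u \<in> pi_hom X x Z z"
  unfolding pi_hom_def using induced_hom_compose pointed_maps_compose by fastforce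

lemma pi_hom_id: "(\<lambda>A \<in> carrier (fundamental_group X x). A) \<in> pi_hom X x X x"
  unfolding pi_hom_def using induced_hom_id id_pointed_map by (metis image_eqI)

lemma pi_hom_funcset:
  "u \<in> pi_hom X x Y y \<Longrightarrow> u \<in> carrier (fundamental_group X x) \<rightarrow> carrier (fundamental_group Y y)"
  by (auto simp: pi_hom_def carrier_fundamental_group induced_hom_loop_class loops_compose)

lemma pi_hom_extensional:
  "u \<in> pi_hom X x Y y \<Longrightarrow> u \<in> extensional (carrier (fundamental_group X x))"
  by (auto simp: pi_hom_def induced_hom_def)

section \<open>Concatenation of loops and semilocal simple connectedness\<close>

lemma loop_homotopic_concat:
  assumes "loop_homotopic X x p p'" "loop_homotopic X x q q'"
  shows "loop_homotopic X x (loop_concat p q) (loop_concat p' q')"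
proof -
  obtain h where h: "continuous_map (top_of_set ({0..1::real} \<times> {0..1::real})) X h"
    "\<forall>t. h (0,t) = p t" "\<forall>t. h (1,t) = p' t" "\<forall>s\<in>{0..1}. h (s,0) = x \<and> h (s,1) = x"
    by (rule loop_homotopicE[OF assms(1)])
  obtain k where k: "continuous_map (top_of_set ({0..1::real} \<times> {0..1::real})) X k"
    "\<forall>t. k (0,t) = q t" "\<forall>t. k (1,t) = q' t" "\<forall>s\<in>{0..1}. k (s,0) = x \<and> k (s,1) = x"
    by (rule loop_homotopicE[OF assms(2)])
  define H where "H = (\<lambda>z. if snd z \<le> 1/2 then (h \<circ> (\<lambda>z. (fst z, 2 * snd z))) z
      else (k \<circ> (\<lambda>z. (fst z, 2 * snd z - 1))) z)"
  have "continuous_map (top_of_set ({0..1} \<times> {0..1})) X H"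
    unfolding H_def
  proof (rule continuous_map_cases_le)
    show "continuous_map (subtopology (top_of_set ({0..1} \<times> {0..1}))
        {z \<in> topspace (top_of_set ({0..1} \<times> {0..1})). snd z \<le> 1/2}) X (h \<circ> (\<lambda>z. (fst z, 2 * snd z)))"
      using h(1)
      by (rule continuous_map_compose[rotated])
        (auto simp: subtopology_subtopology continuous_map_in_subtopology intro!: continuous_intros)
    show "continuous_map (subtopology (top_of_set ({0..1} \<times> {0..1}))
        {z \<in> topspace (top_of_set ({0..1} \<times> {0..1})). 1/2 \<le> snd z}) X (k \<circ> (\<lambda>z. (fst z, 2 * snd z - 1)))"
      using k(1)
      by (rule continuous_map_compose[rotated])
        (auto simp: subtopology_subtopology continuous_map_in_subtopology intro!: continuous_intros)
    show "(h \<circ> (\<lambda>z. (fst z, 2 * snd z))) z = (k \<circ> (\<lambda>z. (fst z, 2 * snd z - 1))) z"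
      if "z \<in> topspace (top_of_set ({0..1} \<times> {0..1}))" "snd z = 1/2" for z
      proof -
      have "(h \<circ> (\<lambda>z. (fst z, 2 * snd z))) z = h (fst z, 1)"
        "(k \<circ> (\<lambda>z. (fst z, 2 * snd z - 1))) z = k (fst z, 0)"
        unfolding o_def that(2) by simp_all
      moreover have "fst z \<in> {0..1}" using that(1) by auto
      ultimately show ?thesis using h(4) k(4) by simp
    qed
  qed (auto intro!: continuous_intros)
  then show ?thesis
    by (rule loop_homotopicI) (use h k in \<open>auto simp: H_def loop_concat_def\<close>)
qed

lemma loops_concat: "\<lbrakk>p \<in> loops X x; q \<in> loops X x\<rbrakk> \<Longrightarrow> loop_concat p q \<in> loops X x"
  by (rule loop_homotopic_imp_loops(1)[OF loop_homotopic_concat[OF loop_homotopic_refl loop_homotopic_refl]])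

lemma mult_loop_class:
  assumes "p \<in> loops X x" "q \<in> loops X x"
  shows "loop_class X x p \<otimes>\<^bsub>fundamental_group X x\<^esub> loop_class X x q = loop_class X x (loop_concat p q)"
proof -
  have "loop_class X x (loop_concat p' q') = loop_class X x (loop_concat p q)"
    if "p' \<in> loop_class X x p" "q' \<in> loop_class X x q" for p' q'
  proof -
    have "loop_homotopic X x (loop_concat p q) (loop_concat p' q')"
      using that unfolding mem_loop_class by (rule loop_homotopic_concat)
    then show ?thesis
      by (simp only: loop_class_eq_iff[OF loops_concat[OF assms], symmetric])
  qed
  moreover have "p \<in> loop_class X x p" "q \<in> loop_class X x q"
    using assms by (simp_all add: loop_in_loop_class)
  ultimately have "(\<Union>p'\<in>loop_class X x p. \<Union>q'\<in>loop_class X x q. loop_class X x (loop_concat p' q'))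
      = loop_class X x (loop_concat p q)"
    by blast
  then show ?thesis by (simp add: fundamental_group_def)
qed

text \<open>\<open>trivial_homomorphism\<close> includes the homomorphism property, so this is
  required before wildness can be expressed by loops.\<close>

lemma induced_hom_in_hom:
  assumes f: "f \<in> pointed_maps X x Y y"
  shows "induced_hom X x Y y f \<in> hom (fundamental_group X x) (fundamental_group Y y)"
proof (rule homI)
  fix A assume "A \<in> carrier (fundamental_group X x)"
  then show "induced_hom X x Y y f A \<in> carrier (fundamental_group Y y)"
    using f by (auto simp: carrier_fundamental_group induced_hom_loop_class loops_compose)
next
  fix A B assume "A \<in> carrier (fundamental_group X x)" "B \<in> carrier (fundamental_group X x)"
  then obtain p q where pq: "A = loop_class X x p" "p \<in> loops X x" "B = loop_class X x q" "q \<in> loops X x"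
    by (auto simp: carrier_fundamental_group)
  have "f \<circ> loop_concat p q = loop_concat (f \<circ> p) (f \<circ> q)"
    by (auto simp: loop_concat_def)
  then show "induced_hom X x Y y f (A \<otimes>\<^bsub>fundamental_group X x\<^esub> B) =
      induced_hom X x Y y f A \<otimes>\<^bsub>fundamental_group Y y\<^esub> induced_hom X x Y y f B"
    using f pq by (simp add: mult_loop_class induced_hom_loop_class loops_concat loops_compose)
qed

lemma semilocally_simply_connected_at_iff:
  "semilocally_simply_connected_at X x \<longleftrightarrow>
    (\<exists>U. openin X U \<and> x \<in> U \<and> (\<forall>p\<in>loops (subtopology X U) x. loop_homotopic X x p (\<lambda>_. x)))"
proof -
  have "trivial_homomorphism (fundamental_group (subtopology X U) x) (fundamental_group X x)
          (induced_hom (subtopology X U) x X x id) \<longleftrightarrow>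
        (\<forall>p\<in>loops (subtopology X U) x. loop_homotopic X x p (\<lambda>_. x))" for U
  proof -
    have i: "id \<in> pointed_maps (subtopology X U) x X x"
      by (simp add: pointed_maps_def continuous_map_from_subtopology)
    have "trivial_homomorphism (fundamental_group (subtopology X U) x) (fundamental_group X x)
          (induced_hom (subtopology X U) x X x id) \<longleftrightarrow>
        (\<forall>p\<in>loops (subtopology X U) x. loop_class X x p = loop_class X x (\<lambda>_. x))"
      using induced_hom_in_hom[OF i]
      by (simp add: trivial_homomorphism_def carrier_fundamental_group induced_hom_loop_class[OF i])
        (simp add: fundamental_group_def)
    also have "\<dots> \<longleftrightarrow> (\<forall>p\<in>loops (subtopology X U) x. loop_homotopic X x p (\<lambda>_. x))"
    proof (rule ball_cong[OF refl])
      fix p assume "p \<in> loops (subtopology X U) x"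
      then have "p \<in> loops X x" using loops_compose[OF i] by simp
      then show "loop_class X x p = loop_class X x (\<lambda>_. x) \<longleftrightarrow> loop_homotopic X x p (\<lambda>_. x)"
        by (rule loop_class_eq_iff)
    qed
    finally show ?thesis .
  qed
  then show ?thesis unfolding semilocally_simply_connected_at_def by simp
qed

text \<open>A loop near \<open>a\<close> is carried by \<open>j\<close> to a loop near
  \<open>j a\<close>; a null-homotopy of the latter in \<open>Z\<close> is brought back to
  \<open>X\<close> by \<open>r\<close>. Contrapositively, wild points of a summand remain wild in
  the join.\<close>

lemma semilocally_simply_connected_at_retract:
  assumes j: "continuous_map X Z j" and r: "continuous_map Z X r"
    and rj: "\<And>a. a \<in> topspace X \<Longrightarrow> r (j a) = a"
    and a: "a \<in> topspace X" and Z: "semilocally_simply_connected_at Z (j a)"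
  shows "semilocally_simply_connected_at X a"
proof -
  obtain U where U: "openin Z U" "j a \<in> U"
    "\<forall>p\<in>loops (subtopology Z U) (j a). loop_homotopic Z (j a) p (\<lambda>_. j a)"
    using Z unfolding semilocally_simply_connected_at_iff by (elim exE conjE) (rule that)
  define U' where "U' = {b \<in> topspace X. j b \<in> U}"
  have "loop_homotopic X a p (\<lambda>_. a)" if p: "p \<in> loops (subtopology X U') a" for p
  proof -
    have jU: "j \<in> pointed_maps (subtopology X U') a (subtopology Z U) (j a)"
      using j by (auto simp: pointed_maps_def continuous_map_in_subtopology U'_def
          continuous_map_from_subtopology)
    have "r \<in> pointed_maps Z (j a) X a" using r rj a by (simp add: pointed_maps_def)
    from loop_homotopic_compose[OF this bspec[OF U(3) loops_compose[OF jU p]]]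
    have hom: "loop_homotopic X a (r \<circ> (j \<circ> p)) (\<lambda>_. a)" using rj a by (simp add: o_def)
    have "p t \<in> topspace X" if "t \<in> {0..1}" for t
      using p that by (auto simp: loops_def pathin_def continuous_map_def)
    then show ?thesis
      by (intro homotopic_with_eq[OF hom]) (auto simp: rj)
  qed
  moreover have "openin X U'" "a \<in> U'"
    using U j a by (auto simp: U'_def openin_continuous_map_preimage)
  ultimately show ?thesis unfolding semilocally_simply_connected_at_iff by (intro exI[of _ U']) simp
qed

section \<open>Joins\<close>

text \<open>This is the retraction of the join onto summand \<open>i\<close> that collapses all
  other summands: a class without a representative in summand \<open>i\<close> goes to the default
  \<open>x i\<close>, and the class of the base points goes there too.\<close>

definition join_proj :: "('i \<Rightarrow> 'a) \<Rightarrow> 'i \<Rightarrow> ('i \<times> 'a) set \<Rightarrow> 'a" where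
  "join_proj x i c = (if \<exists>a. (i, a) \<in> c then THE a. (i, a) \<in> c else x i)"

locale pointed_spaces =
  fixes I :: "'i set" and X :: "'i \<Rightarrow> 'a topology" and x :: "'i \<Rightarrow> 'a"
  assumes base_in: "i \<in> I \<Longrightarrow> x i \<in> topspace (X i)"
begin

abbreviation "Z \<equiv> join_space I X x"
abbreviation "z \<equiv> join_base I x"
abbreviation "j \<equiv> join_in I X x"
abbreviation "r \<equiv> join_proj x"

lemma equiv_rel: "equiv (topspace (sum_topology X I)) (join_rel I X x)"
  using base_in by (rule equiv_join_rel)

lemma topspace_join_quotient: "topspace Z = topspace (sum_topology X I) // join_rel I X x"
  unfolding join_space_def by (rule topspace_quotient_topology[OF equiv_rel])

lemma join_in_eq:
  assumes "i \<in> I" "a \<in> topspace (X i)"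
  shows "j i a = (if a = x i then z else {(i, a)})"
  using assms base_in by (auto simp: join_in_def join_rel_def join_base_def)

lemma join_in_base: "i \<in> I \<Longrightarrow> j i (x i) = z"
  by (simp add: join_in_eq base_in)

lemma topspace_join: "topspace Z = (\<Union>i\<in>I. j i ` topspace (X i))"
  unfolding topspace_join_quotient quotient_def by (fastforce simp: join_in_def)

lemma join_in_topspace: "\<lbrakk>i \<in> I; a \<in> topspace (X i)\<rbrakk> \<Longrightarrow> j i a \<in> topspace Z"
  unfolding topspace_join by blast

lemma join_proj_in:
  assumes "k \<in> I" "i \<in> I" "a \<in> topspace (X i)"
  shows "r k (j i a) = (if k = i then a else x k)"
  using assms by (auto simp: join_in_eq join_proj_def join_base_def)

lemma join_in_eq_base_iff:
  assumes "i \<in> I" "a \<in> topspace (X i)"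
  shows "j i a = z \<longleftrightarrow> a = x i"
  using join_proj_in[of i i] join_in_base[of i] base_in assms by metis

text \<open>A class is \<open>j i a\<close> for each of its members \<open>(i, a)\<close>, so the
  part of \<open>\<Union>U\<close> in summand \<open>i\<close> is the preimage of \<open>U\<close>
  under \<open>j i\<close>. Hence the join carries the final topology of the maps
  \<open>j i\<close>, and the quotient construction is not unfolded in later continuity
  proofs.\<close>

lemma openin_join_iff:
  assumes "U \<subseteq> topspace Z"
  shows "openin Z U \<longleftrightarrow> (\<forall>i\<in>I. openin (X i) {a \<in> topspace (X i). j i a \<in> U})"
proof -
  have mem: "(i, a) \<in> \<Union>U \<longleftrightarrow> j i a \<in> U" if ia: "i \<in> I" "a \<in> topspace (X i)" for i a
  proof
    assume "(i, a) \<in> \<Union>U"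
    then obtain C where C: "C \<in> U" "(i, a) \<in> C" by blast
    then have "C \<in> topspace (sum_topology X I) // join_rel I X x"
      using assms topspace_join_quotient by blast
    then have "C = j i a"
      unfolding join_in_def using C(2) equiv_rel
      by (metis Image_singleton_iff equiv_class_eq quotientE)
    then show "j i a \<in> U" using C by simp
  next
    assume "j i a \<in> U"
    moreover have "(i, a) \<in> j i a"
      using ia by (auto simp: join_in_def join_rel_def Id_on_def)
    ultimately show "(i, a) \<in> \<Union>U" by blast
  qed
  have sub: "\<Union>U \<subseteq> topspace (sum_topology X I)"
    using assms Union_quotient[OF equiv_rel] topspace_join_quotient by blast
  have "openin Z U \<longleftrightarrow> openin (sum_topology X I) (\<Union>U)"
    unfolding join_space_def openin_quotient_topology[OF equiv_rel]
    using assms topspace_join_quotient by simp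
  also have "\<dots> \<longleftrightarrow> (\<forall>i\<in>I. openin (X i) {a. (i, a) \<in> \<Union>U})"
    using sub by (simp add: openin_sum_topology)
  also have "\<dots> \<longleftrightarrow> (\<forall>i\<in>I. openin (X i) {a \<in> topspace (X i). j i a \<in> U})"
  proof (rule ball_cong[OF refl])
    fix i assume i: "i \<in> I"
    have "{a. (i, a) \<in> \<Union>U} = {a \<in> topspace (X i). j i a \<in> U}"
    proof (rule Collect_cong)
      fix a
      have "a \<in> topspace (X i)" if "(i, a) \<in> \<Union>U" using sub that by fastforce
      then show "(i, a) \<in> \<Union>U \<longleftrightarrow> a \<in> topspace (X i) \<and> j i a \<in> U"
        using mem[OF i, of a] by blast
    qed
    then show "openin (X i) {a. (i, a) \<in> \<Union>U} \<longleftrightarrow> openin (X i) {a \<in> topspace (X i). j i a \<in> U}"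
      by simp
  qed
  finally show ?thesis .
qed

lemma continuous_join_in:
  assumes "i \<in> I"
  shows "continuous_map (X i) Z (j i)"
  unfolding continuous_map_def
proof (intro conjI allI impI)
  show "j i \<in> topspace (X i) \<rightarrow> topspace Z"
    using join_in_topspace assms by blast
  show "openin (X i) {a \<in> topspace (X i). j i a \<in> U}" if "openin Z U" for U
    using openin_join_iff openin_subset that assms by blast
qed

lemma continuous_map_from_join:
  assumes "\<And>i. i \<in> I \<Longrightarrow> continuous_map (X i) Y (f \<circ> j i)"
  shows "continuous_map Z Y f"
  unfolding continuous_map_def
proof (intro conjI allI impI)
  show "f \<in> topspace Z \<rightarrow> topspace Y"
    using assms unfolding topspace_join continuous_map_def by fastforce
  fix U assume U: "openin Y U"
  have "{a \<in> topspace (X i). j i a \<in> {c \<in> topspace Z. f c \<in> U}} = {a \<in> topspace (X i). (f \<circ> j i) a \<in> U}"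
    if "i \<in> I" for i
    using join_in_topspace[OF that] by auto
  then show "openin Z {c \<in> topspace Z. f c \<in> U}"
    using openin_continuous_map_preimage[OF assms U] by (subst openin_join_iff) auto
qed

lemma continuous_join_proj:
  assumes k: "k \<in> I"
  shows "continuous_map Z (X k) (r k)"
proof (rule continuous_map_from_join)
  fix i assume i: "i \<in> I"
  have "continuous_map (X i) (X k) (\<lambda>a. if k = i then a else x k)"
    using base_in[OF k] by (cases "k = i") auto
  then show "continuous_map (X i) (X k) (r k \<circ> j i)"
    by (rule continuous_map_eq) (simp add: join_proj_in i k)
qed

lemma join_proj_ne_imp:
  assumes "k \<in> I" "c \<in> topspace Z" "r k c \<noteq> x k"
  shows "j k (r k c) = c"
proof -
  obtain i a where ia: "i \<in> I" "a \<in> topspace (X i)" "c = j i a"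
    using assms(2) unfolding topspace_join by blast
  then have "k = i" "r k c = a"
    using assms(3) join_proj_in[OF assms(1) ia(1,2)] by (auto split: if_splits)
  then show ?thesis using ia by simp
qed

lemma join_ne_base_imp:
  assumes "c \<in> topspace Z" "c \<noteq> z"
  obtains i where "i \<in> I" "r i c \<noteq> x i"
proof -
  obtain i a where ia: "i \<in> I" "a \<in> topspace (X i)" "c = j i a"
    using assms(1) unfolding topspace_join by blast
  then show ?thesis
    using that[of i] assms(2) join_in_eq_base_iff[of i a] join_proj_in[of i i a] by simp
qed

lemma join_proj_base: "k \<in> I \<Longrightarrow> r k z = x k"
  using join_proj_in[of k k "x k"] join_in_base base_in by simp

lemma join_proj_unique:
  assumes "i \<in> I" "k \<in> I" "c \<in> topspace Z" "r i c \<noteq> x i" "r k c \<noteq> x k"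
  shows "i = k"
proof (rule ccontr)
  assume "i \<noteq> k"
  have "r i c \<in> topspace (X i)"
    using continuous_join_proj[OF assms(1)] assms(3) by (auto simp: continuous_map_def)
  then show False
    using join_proj_in[OF assms(2,1), of "r i c"] join_proj_ne_imp[OF assms(1,3,4)] assms(5) \<open>i \<noteq> k\<close> by simp
qed

lemma join_base_topspace: "I \<noteq> {} \<Longrightarrow> z \<in> topspace Z"
  using join_in_topspace join_in_base base_in by (metis ex_in_conv)

section \<open>Properties that a join inherits from its summands\<close>

text \<open>The projections onto the summands embed the join in the product as the union of the
  coordinate axes through the base points. Finiteness of \<open>I\<close> makes the embedding
  closed, since the image of a closed set is a union of one closed box for each summand.\<close>

lemma metrizable_join:
  assumes fin: "finite I" and met: "\<And>i. i \<in> I \<Longrightarrow> metrizable_space (X i)"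
  shows "metrizable_space Z"
proof -
  define e where "e c = (\<lambda>i\<in>I. r i c)" for c
  have "metrizable_space (product_topology X I)"
    unfolding metrizable_space_product_topology using fin met
    by (auto intro: countable_finite finite_subset[of _ I])
  have cont: "continuous_map Z (product_topology X I) e"
    unfolding continuous_map_componentwise e_def using continuous_join_proj by auto
  have "inj_on e (topspace Z)"
  proof (rule inj_onI)
    fix c c' assume c: "c \<in> topspace Z" "c' \<in> topspace Z" "e c = e c'"
    then have eq: "r i c = r i c'" if "i \<in> I" for i
      using that unfolding e_def by (metis restrict_apply')
    show "c = c'"
    proof (cases "\<exists>i\<in>I. r i c \<noteq> x i")
      case True
      then show ?thesis using eq join_proj_ne_imp c by metis
    next
      case False
      then have "c = z" "c' = z" using eq join_ne_base_imp c by metis+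
      then show ?thesis by simp
    qed
  qed
  moreover have "closed_map Z (product_topology X I) e"
    unfolding closed_map_def
  proof (intro allI impI)
    fix C assume C: "closedin Z C"
    define A where "A i = {a \<in> topspace (X i). j i a \<in> C}" for i
    define S where "S i = (\<lambda>k. if k = i then A i else {x k})" for i
    have "closedin (X i) (A i)" if "i \<in> I" for i
      unfolding A_def using closedin_continuous_map_preimage[OF continuous_join_in[OF that] C] .
    moreover have "closedin (X k) {x k}" if "k \<in> I" for k
      using that base_in met metrizable_imp_t1_space closedin_t1_singleton by metis
    ultimately have "closedin (product_topology X I) (PiE I (S i))" if "i \<in> I" for i
      unfolding closedin_product_topology S_def by simp
    then have "closedin (product_topology X I) (\<Union>i\<in>I. PiE I (S i))"
      using fin by (intro closedin_Union) auto
    moreover have "e ` C = (\<Union>i\<in>I. PiE I (S i))"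
    proof (intro equalityI subsetI)
      fix w assume "w \<in> e ` C"
      then obtain c where c: "c \<in> C" "w = e c" by blast
      then have "c \<in> topspace Z" using closedin_subset[OF C] by blast
      then obtain i a where ia: "i \<in> I" "a \<in> topspace (X i)" "c = j i a"
        unfolding topspace_join by blast
      have "w \<in> PiE I (S i)"
        using c ia by (auto simp: e_def S_def A_def join_proj_in)
      then show "w \<in> (\<Union>i\<in>I. PiE I (S i))" using ia by blast
    next
      fix w assume "w \<in> (\<Union>i\<in>I. PiE I (S i))"
      then obtain i where i: "i \<in> I" "w \<in> PiE I (S i)" by blast
      have a: "w i \<in> A i" using PiE_mem[OF i(2,1)] by (simp add: S_def)
      have wk: "w k = x k" if "k \<in> I" "k \<noteq> i" for k
        using PiE_mem[OF i(2) that(1)] that by (simp add: S_def)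
      have "w = e (j i (w i))"
      proof
        fix k
        show "w k = e (j i (w i)) k"
        proof (cases "k \<in> I")
          case True
          then show ?thesis using wk[OF True] a i by (auto simp: e_def A_def join_proj_in)
        next
          case False
          then show ?thesis using PiE_arb[OF i(2) False] by (simp add: e_def)
        qed
      qed
      moreover have "j i (w i) \<in> C" using a by (simp add: A_def)
      ultimately show "w \<in> e ` C" by (rule image_eqI)
    qed
    ultimately show "closedin (product_topology X I) (e ` C)" by simp
  qed
  ultimately have "embedding_map Z (product_topology X I) e"
    using injective_closed_imp_embedding_map[OF cont] by blast
  then have "Z homeomorphic_space subtopology (product_topology X I) (e ` topspace Z)"
    by (rule embedding_map_imp_homeomorphic_space)
  then show ?thesis
    using homeomorphic_metrizable_space metrizable_space_subtopology
      \<open>metrizable_space (product_topology X I)\<close> by metis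
qed

lemma locally_path_connected_join:
  assumes "\<And>i. i \<in> I \<Longrightarrow> locally_path_connected_space (X i)"
  shows "locally_path_connected_space Z"
proof (rule locally_path_connected_space_quotient_map_image)
  show "locally_path_connected_space (sum_topology X I)"
    using assms by (simp add: locally_path_connected_space_sum_topology)
  show "quotient_map (sum_topology X I) Z (\<lambda>(i, a). j i a)"
    unfolding quotient_map_def
  proof (intro conjI allI impI)
    show "(\<lambda>(i, a). j i a) ` topspace (sum_topology X I) = topspace Z"
      by (auto simp: topspace_join)
    fix U assume U: "U \<subseteq> topspace Z"
    have "openin (sum_topology X I) {p \<in> topspace (sum_topology X I). (case p of (i, a) \<Rightarrow> j i a) \<in> U}
      \<longleftrightarrow> (\<forall>i\<in>I. openin (X i) {a \<in> topspace (X i). j i a \<in> U})"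
      unfolding openin_sum_topology by (auto cong: conj_cong)
    then show "openin (sum_topology X I) {p \<in> topspace (sum_topology X I). (case p of (i, a) \<Rightarrow> j i a) \<in> U}
      \<longleftrightarrow> openin Z U"
      using openin_join_iff[OF U] by simp
  qed
qed

lemma path_connected_join:
  assumes "\<And>i. i \<in> I \<Longrightarrow> path_connected_space (X i)" and "I \<noteq> {}"
  shows "path_connected_space Z"
proof -
  have "path_connectedin Z (\<Union>((\<lambda>i. j i ` topspace (X i)) ` I))"
  proof (rule path_connectedin_Union)
    show "path_connectedin Z S" if "S \<in> (\<lambda>i. j i ` topspace (X i)) ` I" for S
      using that assms(1) continuous_join_in path_connectedin_continuous_map_image
        path_connectedin_topspace by blast
    have "z \<in> j i ` topspace (X i)" if "i \<in> I" for i
      using imageI[OF base_in[OF that], of "j i"] join_in_base[OF that] by simp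
    then have "z \<in> (\<Inter>i\<in>I. j i ` topspace (X i))" by (rule INT_I)
    then show "\<Inter>((\<lambda>i. j i ` topspace (X i)) ` I) \<noteq> {}" by blast
  qed
  then show ?thesis
    using path_connectedin_topspace topspace_join by metis
qed

text \<open>All members of the covers of the \<open>X i\<close> that contain a base point are merged into one set.\<close>
lemma covering_dim_le_join:
  assumes dim: "\<And>i. i \<in> I \<Longrightarrow> covering_dim_le (X i) n" and t1: "\<And>i. i \<in> I \<Longrightarrow> t1_space (X i)"
    and ne: "I \<noteq> {}"
  shows "covering_dim_le Z n"
  unfolding covering_dim_le_def
proof (intro allI impI)
  fix \<U> assume \<U>: "(\<forall>U\<in>\<U>. openin Z U) \<and> \<Union>\<U> = topspace Z"
  define pj where "pj i U = {a \<in> topspace (X i). j i a \<in> U}" for i U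
  have openpj: "openin (X i) (pj i U)" if "i \<in> I" "openin Z U" for i U
    unfolding pj_def by (rule openin_continuous_map_preimage[OF continuous_join_in[OF that(1)] that(2)])
  obtain U0 where U0: "U0 \<in> \<U>" "z \<in> U0" using \<U> join_base_topspace[OF ne] by blast
  \<comment> \<open>Only \<open>pj i U0\<close> contains \<open>x i\<close>, so every member of a
    refinement that contains \<open>x i\<close> lies in it. This is why the merged set
    \<open>B\<close> fits into the single set \<open>U0\<close>.\<close>
  define \<U>' where "\<U>' i = insert (pj i U0) ((\<lambda>U. pj i U - {x i}) ` \<U>)" for i
  have "\<exists>\<V>. (\<forall>V\<in>\<V>. openin (X i) V) \<and> \<Union>\<V> = topspace (X i) \<and> (\<forall>V\<in>\<V>. \<exists>U\<in>\<U>' i. V \<subseteq> U) \<and>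
      (\<forall>a\<in>topspace (X i). finite {V\<in>\<V>. a \<in> V} \<and> card {V\<in>\<V>. a \<in> V} \<le> n + 1)" if i: "i \<in> I" for i
  proof (rule covering_dim_leD[OF dim[OF i]])
    show "openin (X i) U" if "U \<in> \<U>' i" for U
      using that U0 \<U> openpj[OF i] closedin_t1_singleton[OF t1[OF i] base_in[OF i]]
      by (auto simp: \<U>'_def)
    have "x i \<in> pj i U0" using base_in[OF i] join_in_base[OF i] U0 by (simp add: pj_def)
    moreover have "\<exists>U\<in>\<U>. a \<in> pj i U" if "a \<in> topspace (X i)" for a
      using that join_in_topspace[OF i] \<U> by (auto simp: pj_def)
    ultimately have "topspace (X i) \<subseteq> \<Union>(\<U>' i)" unfolding \<U>'_def by blast
    then show "\<Union>(\<U>' i) = topspace (X i)" by (auto simp: \<U>'_def pj_def)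
  qed
  then have "\<exists>\<V>. \<forall>i\<in>I. (\<forall>V\<in>\<V> i. openin (X i) V) \<and> \<Union>(\<V> i) = topspace (X i) \<and>
      (\<forall>V\<in>\<V> i. \<exists>U\<in>\<U>' i. V \<subseteq> U) \<and>
      (\<forall>a\<in>topspace (X i). finite {V\<in>\<V> i. a \<in> V} \<and> card {V\<in>\<V> i. a \<in> V} \<le> n + 1)"
    by (intro bchoice ballI)
  then obtain \<V> where \<V>: "\<forall>i\<in>I. (\<forall>V\<in>\<V> i. openin (X i) V) \<and> \<Union>(\<V> i) = topspace (X i) \<and>
      (\<forall>V\<in>\<V> i. \<exists>U\<in>\<U>' i. V \<subseteq> U) \<and>
      (\<forall>a\<in>topspace (X i). finite {V\<in>\<V> i. a \<in> V} \<and> card {V\<in>\<V> i. a \<in> V} \<le> n + 1)"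
    by (rule exE)
  have op: "openin (X i) V" and ref: "\<exists>U\<in>\<U>' i. V \<subseteq> U" and sub: "V \<subseteq> topspace (X i)"
    if "i \<in> I" "V \<in> \<V> i" for i V
    using \<V> that by blast+
  have cov: "\<Union>(\<V> i) = topspace (X i)" if "i \<in> I" for i using \<V> that by blast
  have ord: "finite {V\<in>\<V> i. a \<in> V}" "card {V\<in>\<V> i. a \<in> V} \<le> n + 1"
    if "i \<in> I" "a \<in> topspace (X i)" for i a
    using \<V> that by blast+
  define N where "N i = \<Union>{V\<in>\<V> i. x i \<in> V}" for i
  define B where "B = (\<Union>i\<in>I. j i ` N i)"
  define \<W> where "\<W> = insert B {j i ` V | i V. i \<in> I \<and> V \<in> \<V> i \<and> x i \<notin> V}"
  have xN: "x i \<in> N i" if "i \<in> I" for i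
    using cov[OF that] base_in[OF that] unfolding N_def by blast
  have Nsub: "N i \<subseteq> topspace (X i)" if "i \<in> I" for i
    using sub[OF that] unfolding N_def by blast
  have inB: "j k a \<in> B \<longleftrightarrow> a \<in> N k" if k: "k \<in> I" "a \<in> topspace (X k)" for k a
  proof
    assume "j k a \<in> B"
    then obtain i b where ib: "i \<in> I" "b \<in> N i" "j k a = j i b" unfolding B_def by blast
    then have "b \<in> topspace (X i)" using Nsub by blast
    then have "a = (if k = i then b else x k)"
      using join_proj_in[OF k(1) ib(1)] join_proj_in[OF k(1) k] ib(3) by simp
    then show "a \<in> N k" using ib xN[OF k(1)] by (auto split: if_splits)
  qed (use k in \<open>auto simp: B_def\<close>)
  have inV: "j k a \<in> j i ` V \<longleftrightarrow> k = i \<and> a \<in> V"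
    if k: "k \<in> I" "a \<in> topspace (X k)" and i: "i \<in> I" "V \<in> \<V> i" "x i \<notin> V" for k a i V
  proof
    assume "j k a \<in> j i ` V"
    then obtain b where b: "b \<in> V" "j k a = j i b" by blast
    then have "b \<in> topspace (X i)" using sub i by blast
    then have "b = (if i = k then a else x i)"
      using join_proj_in[OF i(1) k] join_proj_in[OF i(1) i(1)] b(2) by simp
    then show "k = i \<and> a \<in> V" using b i(3) by (auto split: if_splits)
  qed auto
  have WZ: "W \<subseteq> topspace Z" if "W \<in> \<W>" for W
    using that Nsub sub join_in_topspace unfolding \<W>_def B_def by fastforce
  have WX: "pj k W = (if W = B then N k else \<Union>{V \<in> \<V> k. x k \<notin> V \<and> W = j k ` V})"
    if k: "k \<in> I" and W: "W \<in> \<W>" for k W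
  proof (cases "W = B")
    case True
    then show ?thesis using inB[OF k] Nsub[OF k] by (auto simp: pj_def)
  next
    case False
    then obtain i V where iV: "W = j i ` V" "i \<in> I" "V \<in> \<V> i" "x i \<notin> V"
      using W unfolding \<W>_def by blast
    have "pj k W \<subseteq> \<Union>{V \<in> \<V> k. x k \<notin> V \<and> W = j k ` V}"
    proof
      fix a assume "a \<in> pj k W"
      then have "k = i \<and> a \<in> V"
        using inV[OF k _ iV(2-4)] iV(1) by (auto simp: pj_def)
      then show "a \<in> \<Union>{V \<in> \<V> k. x k \<notin> V \<and> W = j k ` V}" using iV by blast
    qed
    moreover have "\<Union>{V \<in> \<V> k. x k \<notin> V \<and> W = j k ` V} \<subseteq> pj k W"
      using sub[OF k] by (auto simp: pj_def)
    ultimately show ?thesis using False by simp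
  qed
  show "\<exists>\<W>. (\<forall>W\<in>\<W>. openin Z W) \<and> \<Union>\<W> = topspace Z \<and> (\<forall>W\<in>\<W>. \<exists>U\<in>\<U>. W \<subseteq> U) \<and>
      (\<forall>c\<in>topspace Z. finite {W\<in>\<W>. c \<in> W} \<and> card {W\<in>\<W>. c \<in> W} \<le> n + 1)"
  proof (intro exI[of _ \<W>] conjI ballI)
    fix W assume W: "W \<in> \<W>"
    have "openin (X k) (pj k W)" if "k \<in> I" for k
      using WX[OF that W] op[OF that] by (auto simp: N_def intro!: openin_Union)
    then show "openin Z W" using openin_join_iff[OF WZ[OF W]] unfolding pj_def by blast
    show "\<exists>U\<in>\<U>. W \<subseteq> U"
    proof (cases "W = B")
      case True
      have "j i a \<in> U0" if i: "i \<in> I" and a: "a \<in> N i" for i a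
      proof -
        obtain V where V: "V \<in> \<V> i" "x i \<in> V" "a \<in> V" using a unfolding N_def by blast
        obtain U where "U \<in> \<U>' i" "V \<subseteq> U" using ref[OF i V(1)] by blast
        then have "V \<subseteq> pj i U0" using V(2) unfolding \<U>'_def by blast
        then show ?thesis using V(3) by (auto simp: pj_def)
      qed
      then show ?thesis using True U0 unfolding B_def by blast
    next
      case False
      then obtain i V where iV: "W = j i ` V" "i \<in> I" "V \<in> \<V> i"
        using W unfolding \<W>_def by blast
      obtain U where "U \<in> \<U>' i" "V \<subseteq> U" using ref[OF iV(2,3)] by blast
      then have "\<exists>U\<in>\<U>. V \<subseteq> pj i U" using U0 unfolding \<U>'_def by blast
      then obtain U where U: "U \<in> \<U>" "V \<subseteq> pj i U" by blast
      have "W \<subseteq> U" unfolding iV(1) using U(2) by (auto simp: pj_def)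
      then show ?thesis using U(1) by blast
    qed
  next
    have "c \<in> \<Union>\<W>" if c: "c \<in> topspace Z" for c
    proof -
      obtain i a where ia: "i \<in> I" "a \<in> topspace (X i)" "c = j i a"
        using c unfolding topspace_join by blast
      obtain V where V: "V \<in> \<V> i" "a \<in> V" using cov[OF ia(1)] ia(2) by blast
      show ?thesis
      proof (cases "x i \<in> V")
        case True
        then have "a \<in> N i" using V unfolding N_def by blast
        then have "c \<in> B" using ia inB by simp
        then show ?thesis unfolding \<W>_def by blast
      next
        case False
        then have "j i ` V \<in> \<W>" using V ia(1) unfolding \<W>_def by blast
        then show ?thesis using ia V by blast
      qed
    qed
    then show "\<Union>\<W> = topspace Z" using WZ by blast
  next
    fix c assume c: "c \<in> topspace Z"
    obtain k a where ka: "k \<in> I" "a \<in> topspace (X k)" "c = j k a"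
      using c unfolding topspace_join by blast
    \<comment> \<open>Merging can only lower the number of members at a point, so the count at
      \<open>c\<close> is bounded by the count at \<open>a\<close> in a single summand. If
      \<open>c\<close> is the base point, any summand serves.\<close>
    define \<phi> where "\<phi> V = (if x k \<in> V then B else j k ` V)" for V
    have sub: "{W\<in>\<W>. c \<in> W} \<subseteq> \<phi> ` {V\<in>\<V> k. a \<in> V}"
    proof
      fix W assume "W \<in> {W\<in>\<W>. c \<in> W}"
      then have W: "W \<in> \<W>" "a \<in> pj k W" using ka by (auto simp: pj_def)
      show "W \<in> \<phi> ` {V\<in>\<V> k. a \<in> V}"
      proof (cases "W = B")
        case True
        then obtain V where "V \<in> \<V> k" "x k \<in> V" "a \<in> V"
          using W WX[OF ka(1) W(1)] by (auto simp: N_def)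
        then show ?thesis using True by (intro image_eqI[of _ _ V]) (auto simp: \<phi>_def)
      next
        case False
        then obtain V where "V \<in> \<V> k" "x k \<notin> V" "a \<in> V" "W = j k ` V"
          using W WX[OF ka(1) W(1)] by auto
        then show ?thesis by (intro image_eqI[of _ _ V]) (auto simp: \<phi>_def)
      qed
    qed
    note o = ord[OF ka(1,2)]
    show "finite {W\<in>\<W>. c \<in> W}" using finite_subset[OF sub finite_imageI[OF o(1)]] .
    show "card {W\<in>\<W>. c \<in> W} \<le> n + 1"
      using card_mono[OF finite_imageI[OF o(1)] sub] card_image_le[OF o(1), of \<phi>] o(2) by linarith
  qed
qed

lemma Topw_obj_join:
  assumes fin: "finite I" and ne: "I \<noteq> {}" and obj: "\<And>i. i \<in> I \<Longrightarrow> Topw_obj (X i) (x i)"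
  shows "Topw_obj Z z"
proof -
  have X: "metrizable_space (X i)" "covering_dim_le (X i) 1" "\<not> covering_dim_le (X i) 0"
    "locally_path_connected_space (X i)" "path_connected_space (X i)" "wild_space (X i)" if "i \<in> I" for i
    using obj[OF that] by (auto simp: Topw_obj_def pseudo_peano_def has_covering_dim_def)
  have rj: "r i (j i a) = a" if "i \<in> I" "a \<in> topspace (X i)" for i a
    using that by (simp add: join_proj_in)
  obtain i0 where i0: "i0 \<in> I" using ne by blast
  have "\<not> covering_dim_le Z 0"
    using covering_dim_le_retract[OF continuous_join_in[OF i0] continuous_join_proj[OF i0] rj[OF i0]] X(3)[OF i0]
    by blast
  moreover have "covering_dim_le Z 1"
    using X ne metrizable_imp_t1_space by (intro covering_dim_le_join) blast+
  moreover have "topspace Z \<noteq> {}" using join_base_topspace[OF ne] by blast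
  ultimately have "has_covering_dim Z 1" by (simp add: has_covering_dim_def)
  moreover have "wild_space Z"
    unfolding wild_space_def
  proof
    fix c assume "c \<in> topspace Z"
    then obtain i a where ia: "i \<in> I" "a \<in> topspace (X i)" "c = j i a"
      unfolding topspace_join by blast
    show "\<not> semilocally_simply_connected_at Z c"
      using semilocally_simply_connected_at_retract[OF continuous_join_in[OF ia(1)] continuous_join_proj[OF ia(1)] rj[OF ia(1)] ia(2)]
        X(6)[OF ia(1)] ia by (auto simp: wild_space_def)
  qed
  ultimately show ?thesis
    unfolding Topw_obj_def pseudo_peano_def
    using metrizable_join[OF fin X(1)] locally_path_connected_join[OF X(4)]
      path_connected_join[OF X(5) ne] join_base_topspace[OF ne] by simp
qed

section \<open>Maps out of the join and the universal property\<close>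

lemma pointed_map_join_in: "i \<in> I \<Longrightarrow> j i \<in> pointed_maps (X i) (x i) Z z"
  by (simp add: pointed_maps_def continuous_join_in join_in_base)

lemma ex_pointed_map_from_join:
  assumes f: "\<And>i. i \<in> I \<Longrightarrow> f i \<in> pointed_maps (X i) (x i) Y y"
  obtains g where "g \<in> pointed_maps Z z Y y" "\<And>i a. \<lbrakk>i \<in> I; a \<in> topspace (X i)\<rbrakk> \<Longrightarrow> g (j i a) = f i a"
proof -
  \<comment> \<open>Away from the base point exactly one projection of \<open>c\<close> differs from
    its base point, and it names the summand of \<open>c\<close>. At the base point no index
    qualifies, hence the separate case.\<close>
  define g where "g c = (if c = z then y else (let i = (THE i. i \<in> I \<and> r i c \<noteq> x i) in f i (r i c)))" for c
  have gj: "g (j i a) = f i a" if ia: "i \<in> I" "a \<in> topspace (X i)" for i a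
  proof (cases "a = x i")
    case True
    then show ?thesis using f[OF ia(1)] join_in_base ia by (simp add: g_def pointed_maps_def)
  next
    case False
    have "(THE k. k \<in> I \<and> r k (j i a) \<noteq> x k) = i"
      using False ia by (intro the_equality) (auto simp: join_proj_in split: if_splits)
    then show ?thesis using False ia join_in_eq_base_iff by (simp add: g_def join_proj_in)
  qed
  have "continuous_map Z Y g"
  proof (rule continuous_map_from_join)
    fix i assume i: "i \<in> I"
    then have "continuous_map (X i) Y (f i)" using f by (simp add: pointed_maps_def)
    then show "continuous_map (X i) Y (g \<circ> j i)"
      by (rule continuous_map_eq) (simp add: gj i)
  qed
  then show ?thesis
    using that[of g] gj by (simp add: pointed_maps_def g_def)
qed

text \<open>The times at which \<open>l\<close> is away from the base point form an open set. On
  each of its components \<open>l\<close> stays inside one summand, so on the closed interval it is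
  the image of a loop there, for which the hypothesis supplies a homotopy. There may be infinitely
  many components, which \<open>homotopic_infinite_concatenation\<close> handles.\<close>

lemma loop_homotopic_from_join:
  assumes met: "metrizable_space Y" and dim: "covering_dim_le Y 1" and t1: "t1_space Z"
    "\<And>i. i \<in> I \<Longrightarrow> t1_space (X i)"
    and f: "f \<in> pointed_maps Z z Y y" and g: "g \<in> pointed_maps Z z Y y"
    and fg: "\<And>i p. \<lbrakk>i \<in> I; p \<in> loops (X i) (x i)\<rbrakk> \<Longrightarrow> loop_homotopic Y y (f \<circ> (j i \<circ> p)) (g \<circ> (j i \<circ> p))"
    and l: "l \<in> loops Z z"
  shows "loop_homotopic Y y (f \<circ> l) (g \<circ> l)"
proof -
  obtain M d where Md: "Metric_space M d" and Y: "Y = Metric_space.mtopology M d"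
    using met unfolding metrizable_space_def by blast
  interpret Metric_space M d by (rule Md)
  have lc: "continuous_map (top_of_set {0..1}) Z l" and l01: "l 0 = z" "l 1 = z"
    using l by (auto simp: loops_def pathin_def)
  have lZ: "l t \<in> topspace Z" if "t \<in> {0..1}" for t
    using lc that by (auto simp: continuous_map_def)
  have fz: "f z = y" "g z = y" using f g by (auto simp: pointed_maps_def)
  define G where "G = {t \<in> {0..1}. l t \<noteq> z}"
  have G01: "G \<subseteq> {0<..<1}"
    using l01 by (auto simp: G_def less_le)
  have cz: "closedin Z {z}"
    using closedin_t1_singleton[OF t1(1)] lZ[of 0] l01 by simp
  have "closedin (top_of_set {0..1}) {t \<in> {0..1}. l t \<in> {z}}"
    using closedin_continuous_map_preimage[OF lc cz] by simp
  then have "closed {t \<in> {0..1}. l t \<in> {z}}"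
    by (rule closedin_closed_trans) simp
  moreover have "G = {0<..<1} - {t \<in> {0..1}. l t \<in> {z}}"
    using G01 by (auto simp: G_def)
  ultimately have opG: "open G" by (simp add: open_Diff)
  show ?thesis
    unfolding Y
  proof (rule homotopic_infinite_concatenation[OF dim[unfolded Y] _ _ opG G01])
    show "pathin mtopology (f \<circ> l)" "pathin mtopology (g \<circ> l)"
      using loops_compose[OF f l] loops_compose[OF g l] by (auto simp: loops_def Y)
    show "(f \<circ> l) t = y \<and> (g \<circ> l) t = y" if "t \<in> {0..1}" "t \<notin> G" for t
      using that fz by (auto simp: G_def)
    fix a b :: real
    assume ab: "0 \<le> a" "a < b" "b \<le> 1" "a \<notin> G" "b \<notin> G" "{a<..<b} \<subseteq> G"
    define m where "m = (a + b) / 2"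
    have m: "m \<in> {a<..<b}" using ab by (auto simp: m_def)
    have lne: "l t \<noteq> z" if "t \<in> {a<..<b}" for t using that ab by (auto simp: G_def)
    have lab: "l a = z" "l b = z" using ab by (auto simp: G_def)
    have mZ: "l m \<in> topspace Z" using m ab by (intro lZ) auto
    obtain i where i: "i \<in> I" "r i (l m) \<noteq> x i"
      using join_ne_base_imp[OF mZ lne[OF m]] by blast
    define S where "S k = {c \<in> topspace Z. r k c \<in> topspace (X k) - {x k}}" for k
    have opS: "openin Z (S k)" if "k \<in> I" for k
      unfolding S_def using closedin_t1_singleton[OF t1(2)[OF that] base_in[OF that]]
      by (intro openin_continuous_map_preimage[OF continuous_join_proj[OF that]]) (simp add: openin_diff)
    have inS: "c \<in> S k \<longleftrightarrow> r k c \<noteq> x k" if "k \<in> I" "c \<in> topspace Z" for k c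
      using continuous_join_proj[OF that(1)] that(2) by (auto simp: S_def continuous_map_def)
    have "connectedin Z (l ` {a<..<b})"
      using ab by (intro connectedin_continuous_map_image[OF lc]) (auto simp: connectedin_subtopology)
    moreover have "openin Z (S i)" "openin Z (\<Union>k\<in>I - {i}. S k)" using opS i by auto
    moreover have "l ` {a<..<b} \<subseteq> S i \<union> (\<Union>k\<in>I - {i}. S k)"
    proof
      fix c assume "c \<in> l ` {a<..<b}"
      then have c: "c \<in> topspace Z" "c \<noteq> z" using lne lZ ab by auto
      then obtain k where "k \<in> I" "r k c \<noteq> x k" using join_ne_base_imp by blast
      then have "k \<in> I" "c \<in> S k" using inS c by auto
      then show "c \<in> S i \<union> (\<Union>k\<in>I - {i}. S k)" by blast
    qed
    moreover have "S i \<inter> (\<Union>k\<in>I - {i}. S k) \<inter> l ` {a<..<b} = {}"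
    proof -
      have False if "c \<in> S i" "c \<in> S k" "k \<in> I" "k \<noteq> i" for c k
        using that i(1) join_proj_unique[of i k c] by (auto simp: S_def)
      then show ?thesis by blast
    qed
    moreover have "l m \<in> S i \<inter> l ` {a<..<b}" using inS[OF i(1) mZ] i(2) m by blast
    ultimately have "(\<Union>k\<in>I - {i}. S k) \<inter> l ` {a<..<b} = {}"
      unfolding connectedin by blast
    then have "l ` {a<..<b} \<subseteq> S i"
      using \<open>l ` {a<..<b} \<subseteq> S i \<union> (\<Union>k\<in>I - {i}. S k)\<close> by blast
    then have jr: "j i (r i (l t)) = l t" if "t \<in> {a..b}" for t
    proof (cases "t \<in> {a<..<b}")
      case True
      then have "l t \<in> S i"
        using \<open>l ` {a<..<b} \<subseteq> S i\<close> by blast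
      then have "r i (l t) \<noteq> x i" "l t \<in> topspace Z"
        by (auto simp: S_def)
      then show ?thesis using join_proj_ne_imp[OF i(1)] by blast
    next
      case False
      then have "l t = z" using that lab by (cases "t = a") auto
      then show ?thesis using join_proj_base[OF i(1)] join_in_base[OF i(1)] by simp
    qed
    \<comment> \<open>The piece of \<open>l\<close> over \<open>{a..b}\<close>, rescaled to the unit
      interval and read in its summand; by \<open>jr\<close> applying \<open>j i\<close> recovers
      it.\<close>
    define q where "q = r i \<circ> (l \<circ> (\<lambda>t. a + (b - a) * t))"
    have aff: "a + (b - a) * t \<in> {a..b}" if "t \<in> {0..1}" for t
    proof -
      have "(b - a) * t \<le> (b - a) * 1" using that ab by (intro mult_left_mono) auto
      moreover have "(b - a) * t \<ge> 0" using that ab by simp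
      ultimately show ?thesis by simp
    qed
    have "continuous_map (top_of_set {0..1}) (top_of_set {0..1}) (\<lambda>t. a + (b - a) * t)"
      using aff ab by (fastforce simp: continuous_map_in_subtopology intro!: continuous_intros)
    then have "pathin (X i) q"
      unfolding pathin_def q_def
      by (intro continuous_map_compose[OF _ continuous_join_proj[OF i(1)]] continuous_map_compose[OF _ lc])
    then have "q \<in> loops (X i) (x i)"
      using lab join_proj_base[OF i(1)] by (simp add: loops_def q_def)
    from fg[OF i(1) this]
    have "loop_homotopic mtopology y (f \<circ> (j i \<circ> q)) (g \<circ> (j i \<circ> q))" unfolding Y .
    then show "loop_homotopic mtopology y (\<lambda>t. (f \<circ> l) (a + (b - a) * t)) (\<lambda>t. (g \<circ> l) (a + (b - a) * t))"
      by (rule homotopic_with_eq) (use jr aff in \<open>auto simp: q_def\<close>)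
  qed
qed

text \<open>Morphisms are induced by maps, so maps representing the \<open>h i\<close> glue to a map
  \<open>g\<close> on the join, which gives existence. A competitor is likewise induced by some map
  \<open>k\<close>; on the loops of each summand \<open>k\<close> and \<open>g\<close> agree up to
  homotopy, and \<open>loop_homotopic_from_join\<close> extends this to all loops of the
  join.\<close>

lemma pi_coproduct_join:
  assumes fin: "finite I" and ne: "I \<noteq> {}" and obj: "\<And>i. i \<in> I \<Longrightarrow> Topw_obj (X i) (x i)"
  shows "pi_coproduct TYPE('c) I X x Z z (join_injection I X x)"
  unfolding pi_coproduct_def
proof (intro conjI ballI allI impI)
  have Z: "Topw_obj Z z" by (rule Topw_obj_join[OF fin ne obj])
  then show "Topw_obj Z z" .
  show "join_injection I X x i \<in> pi_hom (X i) (x i) Z z" if "i \<in> I" for i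
    unfolding join_injection_def pi_hom_def using pointed_map_join_in[OF that] by blast
  fix Y :: "'c topology" and y h
  assume A: "Topw_obj Y y \<and> (\<forall>i\<in>I. h i \<in> pi_hom (X i) (x i) Y y)"
  have Y: "metrizable_space Y" "covering_dim_le Y 1"
    using A by (auto simp: Topw_obj_def pseudo_peano_def has_covering_dim_def)
  have t1: "t1_space Z" "\<And>i. i \<in> I \<Longrightarrow> t1_space (X i)"
    using Z obj by (auto simp: Topw_obj_def pseudo_peano_def metrizable_imp_t1_space)
  have "\<forall>i\<in>I. \<exists>f. f \<in> pointed_maps (X i) (x i) Y y \<and> h i = induced_hom (X i) (x i) Y y f"
    using A unfolding pi_hom_def by blast
  then obtain f where f: "\<And>i. i \<in> I \<Longrightarrow> f i \<in> pointed_maps (X i) (x i) Y y"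
    "\<And>i. i \<in> I \<Longrightarrow> h i = induced_hom (X i) (x i) Y y (f i)"
    by metis
  obtain g where g: "g \<in> pointed_maps Z z Y y" "\<And>i a. \<lbrakk>i \<in> I; a \<in> topspace (X i)\<rbrakk> \<Longrightarrow> g (j i a) = f i a"
    using ex_pointed_map_from_join[OF f(1)] by blast
  have comp: "compose (carrier (fundamental_group (X i) (x i))) (induced_hom Z z Y y k) (join_injection I X x i)
      = induced_hom (X i) (x i) Y y (k \<circ> j i)" if "i \<in> I" "k \<in> pointed_maps Z z Y y" for i k
    unfolding join_injection_def by (rule induced_hom_compose[OF pointed_map_join_in[OF that(1)] that(2)])
  have gj: "induced_hom (X i) (x i) Y y (g \<circ> j i) = h i" if i: "i \<in> I" for i
  proof -
    have gji: "g \<circ> j i \<in> pointed_maps (X i) (x i) Y y"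
      by (rule pointed_maps_compose[OF pointed_map_join_in[OF i] g(1)])
    \<comment> \<open>\<open>g \<circ> j i\<close> and \<open>f i\<close> agree only on
      \<open>topspace (X i)\<close>, whereas a loop may have arbitrary values outside
      \<open>{0..1}\<close>; so the composites are compared up to homotopy and not as
      functions.\<close>
    have "loop_homotopic Y y (g \<circ> j i \<circ> p) (f i \<circ> p)" if p: "p \<in> loops (X i) (x i)" for p
    proof (rule homotopic_with_eq[OF loop_homotopic_refl[OF loops_compose[OF gji p]]])
      have "p t \<in> topspace (X i)" if "t \<in> {0..1}" for t
        using p that by (auto simp: loops_def pathin_def continuous_map_def)
      then show "(f i \<circ> p) t = (g \<circ> j i \<circ> p) t" if "t \<in> topspace (top_of_set {0..1})" for t
        using that g(2)[OF i] by simp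
    qed auto
    then show ?thesis
      unfolding f(2)[OF i] using induced_hom_eq_iff[OF gji f(1)[OF i]] by blast
  qed
  show "\<exists>!u. u \<in> pi_hom Z z Y y \<and>
      (\<forall>i\<in>I. compose (carrier (fundamental_group (X i) (x i))) u (join_injection I X x i) = h i)"
  proof (rule ex1I[of _ "induced_hom Z z Y y g"])
    show "induced_hom Z z Y y g \<in> pi_hom Z z Y y \<and>
      (\<forall>i\<in>I. compose (carrier (fundamental_group (X i) (x i))) (induced_hom Z z Y y g) (join_injection I X x i) = h i)"
      using g(1) comp gj by (auto simp: pi_hom_def)
    fix u
    assume u: "u \<in> pi_hom Z z Y y \<and>
      (\<forall>i\<in>I. compose (carrier (fundamental_group (X i) (x i))) u (join_injection I X x i) = h i)"
    then obtain k where k: "k \<in> pointed_maps Z z Y y" "u = induced_hom Z z Y y k"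
      unfolding pi_hom_def by blast
    have "loop_homotopic Y y (k \<circ> l) (g \<circ> l)" if l: "l \<in> loops Z z" for l
    proof (rule loop_homotopic_from_join[OF Y t1 k(1) g(1) _ l])
      fix i p assume i: "i \<in> I" and p: "p \<in> loops (X i) (x i)"
      have "induced_hom (X i) (x i) Y y (k \<circ> j i) = induced_hom (X i) (x i) Y y (g \<circ> j i)"
        using u comp[OF i k(1)] gj[OF i] i k(2) by simp
      then have "loop_homotopic Y y (k \<circ> j i \<circ> p) (g \<circ> j i \<circ> p)"
        using induced_hom_eq_iff[OF pointed_maps_compose[OF pointed_map_join_in[OF i] k(1)]
            pointed_maps_compose[OF pointed_map_join_in[OF i] g(1)]] p by blast
      then show "loop_homotopic Y y (k \<circ> (j i \<circ> p)) (g \<circ> (j i \<circ> p))" by (simp only: comp_assoc)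
    qed
    then show "u = induced_hom Z z Y y g"
      unfolding k(2) using induced_hom_eq_iff[OF k(1) g(1)] by blast
  qed
qed

end

section \<open>Uniqueness of coproducts\<close>

lemma pi_coproduct_mediating:
  assumes "pi_coproduct TYPE('c) I X x Z z j" and "Topw_obj (Y :: 'c topology) y"
    and "\<And>i. i \<in> I \<Longrightarrow> h i \<in> pi_hom (X i) (x i) Y y"
  shows "\<exists>!u. u \<in> pi_hom Z z Y y \<and> (\<forall>i\<in>I. compose (carrier (fundamental_group (X i) (x i))) u (j i) = h i)"
  using assms unfolding pi_coproduct_def by simp

lemma pi_coproduct_injection:
  "\<lbrakk>pi_coproduct TYPE('c) I X x Z z j; i \<in> I\<rbrakk> \<Longrightarrow> j i \<in> pi_hom (X i) (x i) Z z"
  unfolding pi_coproduct_def by simp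

lemma pi_coproduct_obj: "pi_coproduct TYPE('c) I X x Z z j \<Longrightarrow> Topw_obj Z z"
  unfolding pi_coproduct_def by simp

text \<open>Both \<open>w\<close> and the identity mediate between the injections and themselves.
  The test object is \<open>Z\<close>, so the universal property is used at its own type of
  points.\<close>

lemma pi_coproduct_endo_eq_id:
  assumes Z: "pi_coproduct TYPE('b) I X x (Z :: 'b topology) z j"
    and w: "w \<in> pi_hom Z z Z z"
    and eq: "\<And>i. i \<in> I \<Longrightarrow> compose (carrier (fundamental_group (X i) (x i))) w (j i) = j i"
  shows "w = (\<lambda>A \<in> carrier (fundamental_group Z z). A)"
proof -
  have "compose (carrier (fundamental_group (X i) (x i))) (\<lambda>A \<in> carrier (fundamental_group Z z). A) (j i) = j i"
    if "i \<in> I" for i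
  proof (rule ext)
    fix A
    show "compose (carrier (fundamental_group (X i) (x i))) (\<lambda>A \<in> carrier (fundamental_group Z z). A) (j i) A = j i A"
      using pi_hom_funcset[OF pi_coproduct_injection[OF Z that]]
        pi_hom_extensional[OF pi_coproduct_injection[OF Z that]]
      by (auto simp: compose_def extensional_def)
  qed
  then have "(\<lambda>A \<in> carrier (fundamental_group Z z). A) \<in> pi_hom Z z Z z \<and>
      (\<forall>i\<in>I. compose (carrier (fundamental_group (X i) (x i))) (\<lambda>A \<in> carrier (fundamental_group Z z). A) (j i) = j i)"
    by (intro conjI ballI pi_hom_id)
  moreover have "w \<in> pi_hom Z z Z z \<and> (\<forall>i\<in>I. compose (carrier (fundamental_group (X i) (x i))) w (j i) = j i)"
    by (intro conjI ballI w eq)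
  moreover have "\<exists>!u. u \<in> pi_hom Z z Z z \<and> (\<forall>i\<in>I. compose (carrier (fundamental_group (X i) (x i))) u (j i) = j i)"
    by (rule pi_coproduct_mediating[OF Z pi_coproduct_obj[OF Z] pi_coproduct_injection[OF Z]])
  ultimately show ?thesis by blast
qed

text \<open>The usual argument, with the test types made explicit: \<open>u\<close> and
  \<open>v\<close> come from testing each object against the type of the other, and the two
  identities from testing each against its own type. Hence the universal property is assumed four
  times.\<close>

lemma pi_coproduct_unique:
  assumes Z: "pi_coproduct TYPE('b) I X x (Z :: 'b topology) z j" "pi_coproduct TYPE('c) I X x Z z j"
    and P: "pi_coproduct TYPE('b) I X x (P :: 'c topology) p k" "pi_coproduct TYPE('c) I X x P p k"
  shows "pi_iso Z z P p"
proof -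
  let ?C = "\<lambda>i. carrier (fundamental_group (X i) (x i))"
  obtain u where u: "u \<in> pi_hom Z z P p" "\<And>i. i \<in> I \<Longrightarrow> compose (?C i) u (j i) = k i"
    using ex1_implies_ex[OF pi_coproduct_mediating[OF Z(2) pi_coproduct_obj[OF P(1)] pi_coproduct_injection[OF P(1)]]]
    by blast
  obtain v where v: "v \<in> pi_hom P p Z z" "\<And>i. i \<in> I \<Longrightarrow> compose (?C i) v (k i) = j i"
    using ex1_implies_ex[OF pi_coproduct_mediating[OF P(1) pi_coproduct_obj[OF Z(1)] pi_coproduct_injection[OF Z(1)]]]
    by blast
  have assoc: "compose (?C i) (compose (carrier (fundamental_group A a)) g f) h = compose (?C i) g (compose (?C i) f h)"
    if "h \<in> pi_hom (X i) (x i) A a" for i A a f g h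
    using pi_hom_funcset[OF that] by (auto simp: compose_def fun_eq_iff)
  have "compose (carrier (fundamental_group Z z)) v u = (\<lambda>A \<in> carrier (fundamental_group Z z). A)"
    using u v by (intro pi_coproduct_endo_eq_id[OF Z(1)] pi_hom_compose)
      (auto simp: assoc[OF pi_coproduct_injection[OF Z(1)]])
  moreover have "compose (carrier (fundamental_group P p)) u v = (\<lambda>A \<in> carrier (fundamental_group P p). A)"
    using u v by (intro pi_coproduct_endo_eq_id[OF P(2)] pi_hom_compose)
      (auto simp: assoc[OF pi_coproduct_injection[OF P(2)]])
  ultimately show ?thesis
    unfolding pi_iso_def using u(1) v(1) by blast
qed

theorem theorem5p2:
  fixes I :: "'i set" and X :: "'i \<Rightarrow> 'a topology" and x :: "'i \<Rightarrow> 'a"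
  assumes "finite I" and "I \<noteq> {}"
    and "\<And>i. i \<in> I \<Longrightarrow> Topw_obj (X i) (x i)"
  shows "pi_coproduct TYPE('c) I X x (join_space I X x) (join_base I x) (join_injection I X x) \<and>
    (\<forall>(P :: 'c topology) p k.
       pi_coproduct TYPE('c) I X x P p k \<and> pi_coproduct TYPE(('i \<times> 'a) set) I X x P p k \<longrightarrow>
       pi_iso (join_space I X x) (join_base I x) P p)"
proof -
  interpret pointed_spaces I X x
    using assms(3) by unfold_locales (simp add: Topw_obj_def)
  show ?thesis
  proof (intro conjI allI impI)
    show "pi_coproduct TYPE('c) I X x Z z (join_injection I X x)"
      by (rule pi_coproduct_join[OF assms])
    fix P :: "'c topology" and p k
    assume P: "pi_coproduct TYPE('c) I X x P p k \<and> pi_coproduct TYPE(('i \<times> 'a) set) I X x P p k"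
    show "pi_iso Z z P p"
      \<comment> \<open>The test type in \<open>pi_coproduct_join\<close> is arbitrary, so the join
        supplies both instances: at its own type of points and at that of \<open>P\<close>.\<close>
      by (rule pi_coproduct_unique[OF pi_coproduct_join[OF assms] pi_coproduct_join[OF assms]
            conjunct2[OF P] conjunct1[OF P]])
  qed
qed

end
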